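(* Let $A,B$ be finite-dimensional Hilbert spaces, $\rho_{AB}\in \mathrm{S}(A\otimes B)$ and $\sigma_A\in\mathrm{S}(A)$. Then, with $\rho_A=\mathrm{tr}_B[\rho_{AB}]$, $$D_{\mathbb{M}}(\rho_A\|\sigma_A)\;\le\; D_{\mathbb{M}}(\rho_{AB}\|\mathcal{C}^{\sigma_A}_{AB})\;\le\; D(\rho_A\|\sigma_A).$$
   Context: $\mathrm{S}(A)$ is the set of density matrices (positive semidefinite, trace one) on the finite-dimensional Hilbert space $A$. $\mathcal{C}^{\sigma_A}_{AB}:=\{\sigma'_{AB}\in\mathrm{S}(A\otimes B):\mathrm{tr}_B[\sigma'_{AB}]=\sigma_A\}$ is the set of extensions of $\sigma_A$. The relative entropy is $D(\rho\|\sigma):=\mathrm{tr}[\rho(\log\rho-\log\sigma)]$ if $\mathrm{supp}\,\rho\subseteq\mathrm{supp}\,\sigma$, and $+\infty$ otherwise. The measured relative entropy is $D_{\mathbb{M}}(\rho\|\sigma):=\sup_{\mathcal{M}}D(\mathcal{M}(\rho)\|\mathcal{M}(\sigma))$, the supremum being over all POVM channels $\mathcal{M}(X)=\sum_x\mathrm{tr}[M_xX]\,|x\rangle\langle x|$ with $\{M_x\}$ a (finite) POVM and $\{|x\rangle\}$ orthonormal. For a set $\mathcal{S}$ of density matrices, $D_{\mathbb{M}}(\rho\|\mathcal{S}):=\inf_{\sigma\in\mathcal{S}}D_{\mathbb{M}}(\rho\|\sigma)$. *)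

theory Defs
  imports
    "HOL-Library.Extended_Real"
    "Jordan_Normal_Form.Matrix"
    "Jordan_Normal_Form.Matrix_Kernel"
    "Jordan_Normal_Form.Schur_Decomposition"
begin

text \<open>
  Finite-dimensional Hilbert spaces are \<open>\<complex>\<^sup>n\<close> with an orthonormal basis fixed; operators on them
  are complex matrices with carrier \<open>carrier_mat n n\<close>.  The dimension is a term, not a type,
  because the number of outcomes of a measurement has to vary inside a supremum.
\<close>

definition mat_trace :: "complex mat \<Rightarrow> complex" where
  "mat_trace A = (\<Sum>i<dim_row A. A $$ (i, i))"

definition psd :: "nat \<Rightarrow> complex mat \<Rightarrow> bool" where
  "psd n A \<longleftrightarrow> A \<in> carrier_mat n n \<and> mat_adjoint A = A \<and>
     (\<forall>v \<in> carrier_vec n. 0 \<le> Re ((A *\<^sub>v v) \<bullet>c v))"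

definition density_mats :: "nat \<Rightarrow> complex mat set" where
  "density_mats n = {\<rho>. psd n \<rho> \<and> mat_trace \<rho> = 1}"

text \<open>
  The space \<open>A \<otimes> B\<close> with \<open>dim A = dA\<close>, \<open>dim B = dB\<close> is \<open>\<complex>\<^sup>d\<close> with \<open>d = dA * dB\<close>; the basis vector
  \<open>e\<^sub>i \<otimes> e\<^sub>k\<close> has index \<open>i * dB + k\<close> (Kronecker product convention).
\<close>

definition ptrace_B :: "nat \<Rightarrow> nat \<Rightarrow> complex mat \<Rightarrow> complex mat" where
  "ptrace_B dA dB X = mat dA dA (\<lambda>(i, j). \<Sum>k<dB. X $$ (i * dB + k, j * dB + k))"

definition extensions :: "nat \<Rightarrow> nat \<Rightarrow> complex mat \<Rightarrow> complex mat set" where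
  "extensions dA dB \<sigma> = {\<sigma>' \<in> density_mats (dA * dB). ptrace_B dA dB \<sigma>' = \<sigma>}"

text \<open>
  Functional calculus for a Hermitian matrix \<open>A = U diag(d) U\<^sup>*\<close> with \<open>U\<close> unitary and \<open>d\<close> real:
  the result \<open>U diag(f d) U\<^sup>*\<close> does not depend on the choice of the diagonalisation.
\<close>

definition hermitian_fun :: "(real \<Rightarrow> real) \<Rightarrow> complex mat \<Rightarrow> complex mat" where
  "hermitian_fun f A = (let n = dim_row A in
     THE B. \<exists>U d. U \<in> carrier_mat n n \<and> mat_adjoint U * U = 1\<^sub>m n \<and>
       A = U * mat_diag n (\<lambda>i. complex_of_real (d i)) * mat_adjoint U \<and>
       B = U * mat_diag n (\<lambda>i. complex_of_real (f (d i))) * mat_adjoint U)"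

text \<open>
  The logarithm of a positive semidefinite matrix is taken on its support and extended by \<open>0\<close>;
  this is the convention \<open>0 log 0 = 0\<close>.
\<close>

definition mat_log :: "complex mat \<Rightarrow> complex mat" where
  "mat_log = hermitian_fun (\<lambda>x. if x = 0 then 0 else ln x)"

definition supp :: "complex mat \<Rightarrow> complex vec set" where
  "supp A = {v \<in> carrier_vec (dim_col A). \<forall>w \<in> mat_kernel A. v \<bullet>c w = 0}"

definition rel_entropy :: "complex mat \<Rightarrow> complex mat \<Rightarrow> ereal" where
  "rel_entropy \<rho> \<sigma> =
     (if supp \<rho> \<subseteq> supp \<sigma> then ereal (Re (mat_trace (\<rho> * (mat_log \<rho> - mat_log \<sigma>)))) else \<infinity>)"

definition povm :: "nat \<Rightarrow> nat \<Rightarrow> (nat \<Rightarrow> complex mat) \<Rightarrow> bool" where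
  "povm n k M \<longleftrightarrow> (\<forall>x<k. psd n (M x)) \<and> mat n n (\<lambda>ij. \<Sum>x<k. M x $$ ij) = 1\<^sub>m n"

text \<open>
  The operator \<open>\<Sum>\<^sub>x tr[M\<^sub>x X] |x\<rangle>\<langle>x|\<close>, with \<open>|x\<rangle>\<close> the standard basis of \<open>\<complex>\<^sup>k\<close>.
\<close>

definition povm_channel :: "nat \<Rightarrow> (nat \<Rightarrow> complex mat) \<Rightarrow> complex mat \<Rightarrow> complex mat" where
  "povm_channel k M X = mat_diag k (\<lambda>x. mat_trace (M x * X))"

definition measured_rel_entropy :: "complex mat \<Rightarrow> complex mat \<Rightarrow> ereal" where
  "measured_rel_entropy \<rho> \<sigma> =
     (SUP (k, M) \<in> {(k, M). povm (dim_row \<rho>) k M}.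
        rel_entropy (povm_channel k M \<rho>) (povm_channel k M \<sigma>))"

definition measured_rel_entropy_set :: "complex mat \<Rightarrow> complex mat set \<Rightarrow> ereal" where
  "measured_rel_entropy_set \<rho> S = (INF \<sigma> \<in> S. measured_rel_entropy \<rho> \<sigma>)"

end

theory Submission
  imports Defs "Jordan_Normal_Form.Spectral_Radius" "HOL-Analysis.Function_Topology"
begin

text \<open>
  The lower bound is data processing: \<open>M\<^sub>x \<otimes> 1\<close> has on \<open>\<rho>\<^sub>A\<^sub>B\<close> the statistics of \<open>M\<^sub>x\<close> on \<open>\<rho>\<^sub>A\<close>.

  For the upper bound write the classical relative entropy variationally, so that
  \<open>D\<^sub>M(\<rho>\<^sub>A\<^sub>B \<parallel> \<tau>) \<le> c\<close> becomes the family of linear constraints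
  \<open>tr \<omega>\<tau> \<ge> \<Sum>\<^sub>x tr[M\<^sub>x \<rho>\<^sub>A\<^sub>B] log w\<^sub>x + 1 - c\<close> with \<open>\<omega> = \<Sum>\<^sub>x w\<^sub>x M\<^sub>x\<close>, indexed by POVMs and positive weights.
  The extensions of \<open>\<sigma>\<^sub>A\<close> form a compact set, so it is enough to satisfy finitely many constraints.
  By convex duality this fails only if some Hermitian \<open>Z\<close> on \<open>A\<close> and a convex combination of the
  constraints satisfy \<open>Z \<otimes> 1 \<ge> \<Sum> l \<omega>\<close> while \<open>tr Z\<sigma>\<^sub>A\<close> is smaller than the combined right-hand
  side. Operator concavity and monotonicity of the logarithm exclude this for \<open>c = D(\<rho>\<^sub>A \<parallel> \<sigma>\<^sub>A)\<close>:
  the measurement term is at most \<open>tr \<rho>\<^sub>A log Z\<close>, and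
  \<open>tr \<rho>\<^sub>A log Z + 1 - tr \<sigma>\<^sub>A Z \<le> D(\<rho>\<^sub>A \<parallel> \<sigma>\<^sub>A)\<close>. Both inequalities come from comparing resolvents and
  integrating over the spectral parameter.
\<close>

section \<open>Adjoints, traces and unitary diagonalisation\<close>

text \<open>The obstacle is the order of quantifiers: one extension has to serve all POVMs at once.
  Two features make the exchange possible. The expression sum p ln w + 1 - sum q w, unlike the
  variant with the logarithm of sum q w, is affine in q, so each constraint on the extension is a
  closed half-space. And POVMs can be mixed: if the i-th is chosen with probability u i, the
  disjoint union of the outcomes is again a POVM, so a convex combination of constraints is a
  statement about one measurement.

  Duality over the positive cone may in general show a gap. Here the partial trace controls the
  trace of a positive matrix, so a least-squares problem over the cone has a minimiser, and its
  residuals are the certificate.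

  The logarithm is reached through 1/(x + t), the maximum of 2 h - (x + t) h^2 over h. Each
  resolvent inequality thus becomes a completed square, even for matrices that do not commute; the
  test operator is the resolvent expected at equality. States may be singular, so logarithms of
  ratios are kept finite by small positive shifts that are removed at the end.\<close>

lemma adjoint_dim [simp]: "dim_row (mat_adjoint A) = dim_col A" "dim_col (mat_adjoint A) = dim_row A"
  by (simp_all add: mat_adjoint_def mat_of_rows_def)

lemma adjoint_index [simp]:
  fixes A :: "complex mat"
  assumes "i < dim_col A" "j < dim_row A"
  shows "mat_adjoint A $$ (i, j) = cnj (A $$ (j, i))"
  using assms by (simp add: mat_adjoint_def mat_of_rows_def)

lemma adjoint_carrier [simp]:
  "A \<in> carrier_mat n m \<Longrightarrow> mat_adjoint A \<in> carrier_mat m n"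
  unfolding carrier_mat_def by simp

lemma adjoint_adjoint [simp]: "mat_adjoint (mat_adjoint A) = (A :: complex mat)"
  by (rule eq_matI) auto

lemma index_mult_mat_sum:
  assumes "A \<in> carrier_mat n m" "B \<in> carrier_mat m p" "i < n" "j < p"
  shows "(A * B) $$ (i, j) = (\<Sum>k<m. A $$ (i, k) * B $$ (k, j))"
  using assms by (simp add: scalar_prod_def lessThan_atLeast0)

lemma square_mult_carrier [simp]:
  "A \<in> carrier_mat n n \<Longrightarrow> B \<in> carrier_mat n n \<Longrightarrow> A * B \<in> carrier_mat n n"
  by (rule mult_carrier_mat)

lemma adjoint_mult:
  fixes A B :: "complex mat"
  assumes "A \<in> carrier_mat n m" "B \<in> carrier_mat m p"
  shows "mat_adjoint (A * B) = mat_adjoint B * mat_adjoint A"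
proof (rule eq_matI)
  fix i j assume "i < dim_row (mat_adjoint B * mat_adjoint A)" "j < dim_col (mat_adjoint B * mat_adjoint A)"
  with assms have ij: "i < p" "j < n" by auto
  have "mat_adjoint (A * B) $$ (i, j) = cnj ((A * B) $$ (j, i))" using ij assms by simp
  also have "\<dots> = (\<Sum>k<m. mat_adjoint B $$ (i, k) * mat_adjoint A $$ (k, j))"
    using assms ij by (subst index_mult_mat_sum[OF assms]) (simp_all add: mult.commute)
  also have "\<dots> = (mat_adjoint B * mat_adjoint A) $$ (i, j)"
    using assms ij by (subst index_mult_mat_sum[of _ p m _ n]) simp_all
  finally show "mat_adjoint (A * B) $$ (i, j) = (mat_adjoint B * mat_adjoint A) $$ (i, j)" .
qed (use assms in auto)

lemma adjoint_one [simp]: "mat_adjoint (1\<^sub>m n) = (1\<^sub>m n :: complex mat)"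
  by (rule eq_matI) auto

lemma trace_mult:
  assumes "A \<in> carrier_mat n m" "B \<in> carrier_mat m n"
  shows "mat_trace (A * B) = (\<Sum>i<n. \<Sum>k<m. A $$ (i, k) * B $$ (k, i))"
proof -
  have "mat_trace (A * B) = (\<Sum>i<n. (A * B) $$ (i, i))" using assms by (simp add: mat_trace_def)
  also have "\<dots> = (\<Sum>i<n. \<Sum>k<m. A $$ (i, k) * B $$ (k, i))"
    by (intro sum.cong refl index_mult_mat_sum[OF assms]) auto
  finally show ?thesis .
qed

lemma trace_comm:
  assumes "A \<in> carrier_mat n m" "B \<in> carrier_mat m n"
  shows "mat_trace (A * B) = mat_trace (B * A)"
  unfolding trace_mult[OF assms] trace_mult[OF assms(2,1)]
  by (subst sum.swap) (simp add: mult.commute)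

lemma trace_add:
  "A \<in> carrier_mat n n \<Longrightarrow> B \<in> carrier_mat n n \<Longrightarrow> mat_trace (A + B) = mat_trace A + mat_trace B"
  by (simp add: mat_trace_def sum.distrib)

lemma trace_minus:
  "A \<in> carrier_mat n n \<Longrightarrow> B \<in> carrier_mat n n \<Longrightarrow> mat_trace (A - B) = mat_trace A - mat_trace B"
  by (simp add: mat_trace_def sum_subtractf)

lemma trace_smult: "A \<in> carrier_mat n n \<Longrightarrow> mat_trace (c \<cdot>\<^sub>m A) = c * mat_trace A"
  by (simp add: mat_trace_def sum_distrib_left)

definition unitary :: "nat \<Rightarrow> complex mat \<Rightarrow> bool" where
  "unitary n U \<longleftrightarrow> U \<in> carrier_mat n n \<and> mat_adjoint U * U = 1\<^sub>m n"

definition spectral :: "nat \<Rightarrow> complex mat \<Rightarrow> (nat \<Rightarrow> real) \<Rightarrow> complex mat" where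
  "spectral n U d = U * mat_diag n (\<lambda>i. complex_of_real (d i)) * mat_adjoint U"

lemma unitary_carrier: "unitary n U \<Longrightarrow> U \<in> carrier_mat n n"
  by (simp add: unitary_def)

lemma unitary_left: "unitary n U \<Longrightarrow> mat_adjoint U * U = 1\<^sub>m n"
  by (simp add: unitary_def)

lemma unitary_right: "unitary n U \<Longrightarrow> U * mat_adjoint U = 1\<^sub>m n"
  unfolding unitary_def by (metis adjoint_carrier mat_mult_left_right_inverse)

lemma unitary_one [simp]: "unitary n (1\<^sub>m n)"
  by (simp add: unitary_def)

lemma unitary_mult:
  assumes "unitary n U" "unitary n V"
  shows "unitary n (U * V)"
proof -
  note c = assms[THEN unitary_carrier]
  have "mat_adjoint (U * V) * (U * V) = mat_adjoint V * ((mat_adjoint U * U) * V)"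
    using c by (simp add: adjoint_mult[OF c] assoc_mult_mat[of _ n n _ n _ n])
  with c assms[THEN unitary_left] show ?thesis by (simp add: unitary_def)
qed

lemma spectral_dim [simp]:
  "dim_row (spectral n U d) = dim_row U" "dim_col (spectral n U d) = dim_row U"
  by (simp_all add: spectral_def)

lemma spectral_carrier [simp]: "U \<in> carrier_mat n n \<Longrightarrow> spectral n U d \<in> carrier_mat n n"
  unfolding spectral_def by (intro mult_carrier_mat[of _ n n]) auto

lemma spectral_index:
  assumes "U \<in> carrier_mat n n" "i < n" "j < n"
  shows "spectral n U d $$ (i, j) = (\<Sum>k<n. d k * U $$ (i, k) * cnj (U $$ (j, k)))"
  unfolding spectral_def using assms
  by (subst index_mult_mat_sum[of _ n n _ n])
     (auto simp: mat_diag_mult_right mult_ac intro!: sum.cong)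

lemma adjoint_spectral:
  assumes "U \<in> carrier_mat n n"
  shows "mat_adjoint (spectral n U d) = spectral n U d"
  by (rule eq_matI) (use assms in \<open>auto simp: spectral_index mult_ac\<close>)

lemma spectral_one: "unitary n U \<Longrightarrow> spectral n U (\<lambda>_. 1) = 1\<^sub>m n"
  using unitary_right[of n U] unitary_carrier[of n U] by (simp add: spectral_def)

lemma spectral_cong: "(\<And>i. i < n \<Longrightarrow> d i = e i) \<Longrightarrow> spectral n U d = spectral n U e"
  by (auto simp: spectral_def mat_diag_def intro!: arg_cong[where f = "\<lambda>D. U * D * _"] cong_mat)

lemma spectral_mult:
  assumes "unitary n U"
  shows "spectral n U d * spectral n U e = spectral n U (\<lambda>i. d i * e i)"
proof -
  note c = unitary_carrier[OF assms]
  let ?D = "mat_diag n (\<lambda>i. complex_of_real (d i))" and ?E = "mat_diag n (\<lambda>i. complex_of_real (e i))"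
  have "spectral n U d * spectral n U e = U * (?D * ((mat_adjoint U * U) * (?E * mat_adjoint U)))"
    using c unfolding spectral_def by (simp add: assoc_mult_mat[of _ n n _ n _ n])
  also have "\<dots> = U * (?D * ?E) * mat_adjoint U"
    using c by (simp add: unitary_left[OF assms] assoc_mult_mat[of _ n n _ n _ n] left_mult_one_mat[of _ n n] del: mat_diag_diag)
  finally show ?thesis by (simp add: spectral_def)
qed

text \<open>Expanding each Hermitian factor in its own eigenbasis gives a double sum with weights
  \<open>a i * b k\<close>. Positivity of traces and the two-basis formula for the relative entropy
  are both read off from it.\<close>

lemma trace_spectral_spectral:
  assumes U: "unitary n U" and V: "unitary n V"
    and X: "X \<in> carrier_mat n n" and Z: "Z \<in> carrier_mat n n"
  shows "mat_trace (spectral n U a * (mat_adjoint X * (spectral n V b * Z))) =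
    (\<Sum>i<n. \<Sum>k<n. complex_of_real (a i * b k) * cnj ((mat_adjoint V * X * U) $$ (k, i)) * (mat_adjoint V * Z * U) $$ (k, i))"
proof -
  note c = U[THEN unitary_carrier] V[THEN unitary_carrier] X Z
  let ?A = "mat_diag n (\<lambda>i. complex_of_real (a i))" and ?B = "mat_diag n (\<lambda>i. complex_of_real (b i))"
  let ?X = "mat_adjoint V * X * U" and ?Z = "mat_adjoint V * Z * U"
  have XZ: "?X \<in> carrier_mat n n" "?Z \<in> carrier_mat n n" using c by auto
  have adj: "mat_adjoint ?X = mat_adjoint U * (mat_adjoint X * V)"
    using c by (subst adjoint_mult[of _ n n _ n]) (auto simp: adjoint_mult[of _ n n _ n])
  have "mat_trace (spectral n U a * (mat_adjoint X * (spectral n V b * Z)))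
      = mat_trace (U * (?A * (mat_adjoint U * (mat_adjoint X * (V * (?B * (mat_adjoint V * Z)))))))"
    using c unfolding spectral_def by (simp add: assoc_mult_mat[of _ n n _ n _ n])
  also have "\<dots> = mat_trace ((?A * (mat_adjoint U * (mat_adjoint X * (V * (?B * (mat_adjoint V * Z)))))) * U)"
    using c by (intro trace_comm[of _ n n]) (auto intro!: mult_carrier_mat[of _ n n])
  also have "(?A * (mat_adjoint U * (mat_adjoint X * (V * (?B * (mat_adjoint V * Z)))))) * U
      = (?A * mat_adjoint ?X) * (?B * ?Z)"
    using c unfolding adj by (simp add: assoc_mult_mat[of _ n n _ n _ n])
  also have "mat_trace \<dots> = (\<Sum>i<n. \<Sum>k<n. complex_of_real (a i * b k) * cnj (?X $$ (k, i)) * ?Z $$ (k, i))"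
    using XZ by (subst trace_mult[of _ n n])
      (auto simp: mat_diag_mult_left[of _ n n] mult_ac simp del: index_mult_mat intro!: sum.cong)
  finally show ?thesis .
qed

section \<open>Spectral theorem for Hermitian matrices\<close>

lemma cscalar_prod_sum:
  fixes v w :: "complex vec"
  assumes "w \<in> carrier_vec n"
  shows "v \<bullet>c w = (\<Sum>i<n. v $ i * cnj (w $ i))"
  using assms by (simp add: scalar_prod_def lessThan_atLeast0)

text \<open>Gram-Schmidt on a basis that starts with \<open>v\<close> leaves its first vector
  unchanged, and normalising the columns costs only a scalar \<open>c\<close> in column 0. A
  multiple of an eigenvector is all that deflation asks for.\<close>

lemma unitary_completion:
  fixes v :: "complex vec"
  assumes v: "v \<in> carrier_vec n" and v0: "v \<noteq> 0\<^sub>v n"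
  shows "\<exists>W c. unitary n W \<and> (\<forall>i<n. W $$ (i, 0) = c * v $ i)"
proof -
  interpret cof_vec_space n "TYPE(complex)" .
  have n: "n \<noteq> 0" using v v0 by (metis carrier_vecD eq_vecI index_zero_vec(2) less_nat_zero_code)
  define b where "b = basis_completion v"
  define ws where "ws = gram_schmidt n b"
  from basis_completion[OF v v0, folded b_def]
  have dist_b: "distinct b" and indep: "\<not> lin_dep (set b)" and b: "set b \<subseteq> carrier_vec n"
    and hdb: "hd b = v" and len_b: "length b = n" by auto
  from hdb len_b n obtain vs where bv: "b = v # vs" by (cases b) auto
  from gram_schmidt_result[OF b dist_b indep refl, folded ws_def]
  have ws: "set ws \<subseteq> carrier_vec n" "corthogonal ws" "length ws = n"
    by (auto simp: len_b)
  from gram_schmidt_hd[OF v, of vs, folded bv] have hdws: "hd ws = v" unfolding ws_def .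
  have ws0: "ws ! 0 = v" using hdws ws(3) n by (cases ws) auto
  have wsc: "ws ! i \<in> carrier_vec n" if "i < n" for i using ws that by auto
  \<comment> \<open>Gram-Schmidt here yields orthogonal but unnormalised vectors; \<open>r j\<close>
    is the norm of the j-th one.\<close>
  define r where "r j = sqrt (\<Sum>i<n. (cmod (ws ! j $ i))\<^sup>2)" for j
  have ip: "(ws ! j \<bullet>c ws ! j) = complex_of_real ((r j)\<^sup>2)" if "j < n" for j
    unfolding cscalar_prod_sum[OF wsc[OF that]] r_def
    by (simp only: real_sqrt_pow2[OF sum_nonneg[OF zero_le_power2]] of_real_sum complex_norm_square)
  have r0: "r j \<noteq> 0" if "j < n" for j
    
  proof -
    have "ws ! j \<bullet>c ws ! j \<noteq> 0" using corthogonalD[OF ws(2), of j j] that ws(3) by simp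
    then show ?thesis unfolding ip[OF that] by simp
  qed
  define W where "W = mat n n (\<lambda>(i, j). ws ! j $ i / complex_of_real (r j))"
  have W: "W \<in> carrier_mat n n" by (simp add: W_def)
  have "mat_adjoint W * W = 1\<^sub>m n"
  proof (rule eq_matI)
    fix i j assume ij: "i < dim_row (1\<^sub>m n :: complex mat)" "j < dim_col (1\<^sub>m n :: complex mat)"
    then have ij: "i < n" "j < n" by auto
    have "(mat_adjoint W * W) $$ (i, j) = (\<Sum>k<n. ws ! j $ k * cnj (ws ! i $ k) / (complex_of_real (r i) * complex_of_real (r j)))"
      using W ij by (subst index_mult_mat_sum[of _ n n _ n]) (auto simp: W_def mult.commute)
    also have "\<dots> = (ws ! j \<bullet>c ws ! i) / (complex_of_real (r i) * complex_of_real (r j))"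
      by (simp add: cscalar_prod_sum[OF wsc[OF ij(1)]] sum_divide_distrib)
    also have "\<dots> = (if i = j then 1 else 0)"
    proof (cases "i = j")
      case True
      then show ?thesis unfolding True ip[OF ij(2)] using r0[OF ij(2)] by (simp add: power2_eq_square)
    next
      case False
      then show ?thesis using corthogonalD[OF ws(2), of j i] ij ws(3) by simp
    qed
    finally show "(mat_adjoint W * W) $$ (i, j) = 1\<^sub>m n $$ (i, j)" using ij by simp
  qed (use W in auto)
  moreover have "\<forall>i<n. W $$ (i, 0) = (1 / complex_of_real (r 0)) * v $ i"
    using n by (simp add: W_def ws0)
  ultimately show ?thesis using W unfolding unitary_def by blast
qed

text \<open>Deflation: in a basis that starts with an eigenvector, column 0 is a multiple of the
  first unit vector, and Hermitian symmetry clears row 0 as well. What remains is a Hermitian block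
  of size m.\<close>

theorem hermitian_spectral:
  assumes "A \<in> carrier_mat n n" "mat_adjoint A = A"
  shows "\<exists>U d. unitary n U \<and> A = spectral n U d"
  using assms
proof (induction n arbitrary: A)
  case 0
  then have "A = spectral 0 (1\<^sub>m 0) (\<lambda>_. 0)" by (intro eq_matI) auto
  then show ?case using unitary_one by blast
next
  case (Suc m)
  let ?n = "Suc m"
  note A = Suc.prems(1)
  from spectrum_non_empty[OF A] obtain e where "eigenvalue A e" by (auto simp: spectrum_def)
  then obtain v where "eigenvector A v e" by (auto simp: eigenvalue_def)
  then have v: "v \<in> carrier_vec ?n" "v \<noteq> 0\<^sub>v ?n" and Av: "A *\<^sub>v v = e \<cdot>\<^sub>v v"
    using A by (auto simp: eigenvector_def)
  from unitary_completion[OF v] obtain W c where W: "unitary ?n W"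
    and Wc: "\<And>i. i < ?n \<Longrightarrow> W $$ (i, 0) = c * v $ i" by auto
  note Wcar = unitary_carrier[OF W]
  define B where "B = mat_adjoint W * (A * W)"
  have B: "B \<in> carrier_mat ?n ?n" using A Wcar by (simp add: B_def)
  have adjB: "mat_adjoint B = B"
    unfolding B_def using A Wcar
    by (simp add: adjoint_mult[of _ ?n ?n _ ?n] Suc.prems(2) assoc_mult_mat[of _ ?n ?n _ ?n _ ?n])
  have Bherm: "B $$ (i, j) = cnj (B $$ (j, i))" if "i < ?n" "j < ?n" for i j
    using adjoint_index[of i B j] B that unfolding adjB by auto
  have AW: "(A * W) $$ (k, 0) = e * W $$ (k, 0)" if "k < ?n" for k
  proof -
    have "(A * W) $$ (k, 0) = c * (\<Sum>l<?n. A $$ (k, l) * v $ l)"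
      using A Wcar that by (subst index_mult_mat_sum[of _ ?n ?n _ ?n])
        (auto simp: Wc sum_distrib_left mult_ac simp del: sum.lessThan_Suc intro!: sum.cong)
    also have "(\<Sum>l<?n. A $$ (k, l) * v $ l) = (A *\<^sub>v v) $ k"
      using A v that by (simp add: scalar_prod_def lessThan_atLeast0 del: sum.lessThan_Suc sum.op_ivl_Suc)
    finally show ?thesis using Av v that by (simp add: Wc)
  qed
  have B0: "B $$ (i, 0) = (if i = 0 then e else 0)" if "i < ?n" for i
  proof -
    have "B $$ (i, 0) = (\<Sum>k<?n. mat_adjoint W $$ (i, k) * (A * W) $$ (k, 0))"
      unfolding B_def using A Wcar that by (intro index_mult_mat_sum[of _ ?n ?n _ ?n]) auto
    also have "\<dots> = e * (\<Sum>k<?n. mat_adjoint W $$ (i, k) * W $$ (k, 0))"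
      unfolding sum_distrib_left by (intro sum.cong refl) (simp add: AW mult.left_commute del: index_mult_mat)
    also have "\<dots> = e * (mat_adjoint W * W) $$ (i, 0)"
      using Wcar that by (subst index_mult_mat_sum[of _ ?n ?n _ ?n]) auto
    finally have "B $$ (i, 0) = e * (mat_adjoint W * W) $$ (i, 0)" .
    then show ?thesis using unitary_left[OF W] that by simp
  qed
  have ereal: "e = complex_of_real (Re e)"
    using Bherm[of 0 0] B0[of 0] by (simp add: complex_eq_iff)
  define B' where "B' = mat m m (\<lambda>(i, j). B $$ (Suc i, Suc j))"
  have "mat_adjoint B' = B'" by (rule eq_matI) (auto simp: B'_def Bherm[symmetric])
  from Suc.IH[OF _ this] obtain U d where U: "unitary m U" and B'U: "B' = spectral m U d"
    by (auto simp: B'_def)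
  note Ucar = unitary_carrier[OF U]
  define V where "V = mat ?n ?n (\<lambda>(i, j). if i = 0 then (if j = 0 then 1 else 0)
     else if j = 0 then 0 else U $$ (i - 1, j - 1))"
  have Vcar: "V \<in> carrier_mat ?n ?n" by (simp add: V_def)
  have V0: "V $$ (i, 0) = (if i = 0 then 1 else 0)" if "i < ?n" for i using that by (simp add: V_def)
  have VS: "V $$ (i, Suc k) = (if i = 0 then 0 else U $$ (i - 1, k))" if "i < ?n" "k < m" for i k
    using that by (simp add: V_def)
  have "mat_adjoint V * V = 1\<^sub>m ?n"
  proof (rule eq_matI)
    fix i j assume "i < dim_row (1\<^sub>m ?n :: complex mat)" "j < dim_col (1\<^sub>m ?n :: complex mat)"
    then have ij: "i < ?n" "j < ?n" by auto
    have s: "(\<Sum>k<m. cnj (U $$ (k, i')) * U $$ (k, j')) = (if i' = j' then 1 else 0)"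
      if "i' < m" "j' < m" for i' j'
    proof -
      have "(\<Sum>k<m. cnj (U $$ (k, i')) * U $$ (k, j')) = (mat_adjoint U * U) $$ (i', j')"
        using Ucar that by (subst index_mult_mat_sum[of _ m m _ m]) auto
      then show ?thesis using that unitary_left[OF U] by simp
    qed
    have "(mat_adjoint V * V) $$ (i, j) = (\<Sum>k<?n. cnj (V $$ (k, i)) * V $$ (k, j))"
      using Vcar ij by (subst index_mult_mat_sum[of _ ?n ?n _ ?n]) (auto simp del: sum.lessThan_Suc)
    also have "\<dots> = (if i = j then 1 else 0)"
      unfolding sum.lessThan_Suc_shift using ij s[of "i - 1" "j - 1"]
      by (cases i; cases j) (auto simp: V_def)
    finally show "(mat_adjoint V * V) $$ (i, j) = 1\<^sub>m ?n $$ (i, j)" using ij by simp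
  qed (use Vcar in auto)
  with Vcar have V: "unitary ?n V" by (simp add: unitary_def)
  define f where "f k = (case k of 0 \<Rightarrow> Re e | Suc k \<Rightarrow> d k)" for k
  have BV: "B = spectral ?n V f"
  proof (rule eq_matI)
    fix i j assume "i < dim_row (spectral ?n V f)" "j < dim_col (spectral ?n V f)"
    with Vcar have ij: "i < ?n" "j < ?n" by auto
    have r: "spectral ?n V f $$ (i, j) = Re e * V $$ (i, 0) * cnj (V $$ (j, 0))
        + (\<Sum>k<m. d k * V $$ (i, Suc k) * cnj (V $$ (j, Suc k)))"
      using ij Vcar by (simp only: spectral_index sum.lessThan_Suc_shift) (simp add: f_def)
    show "B $$ (i, j) = spectral ?n V f $$ (i, j)"
    proof (cases "i = 0 \<or> j = 0")
      case True
      then show ?thesis unfolding r using ij ereal B0[of i] B0[of j] Bherm[of i j]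
        by (auto simp: V0 VS complex_eq_iff)
    next
      case False
      then obtain i' j' where ij': "i = Suc i'" "j = Suc j'" by (metis not0_implies_Suc)
      with ij have lt: "i' < m" "j' < m" by auto
      have "B $$ (i, j) = B' $$ (i', j')" using ij' lt by (simp add: B'_def)
      also have "\<dots> = (\<Sum>k<m. d k * U $$ (i', k) * cnj (U $$ (j', k)))"
        unfolding B'U using Ucar lt by (simp add: spectral_index)
      also have "\<dots> = spectral ?n V f $$ (i, j)" unfolding r using ij' lt by (simp add: V0 VS)
      finally show ?thesis .
    qed
  qed (use B Vcar in auto)
  have "W * (B * mat_adjoint W) = (W * mat_adjoint W) * (A * (W * mat_adjoint W))"
    unfolding B_def using A Wcar by (simp add: assoc_mult_mat[of _ ?n ?n _ ?n _ ?n])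
  then have "A = W * (B * mat_adjoint W)" using A Wcar unitary_right[OF W] by simp
  also have "\<dots> = spectral ?n (W * V) f"
    unfolding BV spectral_def using Vcar Wcar
    by (simp add: adjoint_mult[of _ ?n ?n _ ?n] assoc_mult_mat[of _ ?n ?n _ ?n _ ?n])
  finally show ?case using unitary_mult[OF W V] by blast
qed

section \<open>Positive semidefinite matrices\<close>

lemma trace_add_mult:
  "A \<in> carrier_mat n n \<Longrightarrow> B \<in> carrier_mat n n \<Longrightarrow> X \<in> carrier_mat n n \<Longrightarrow>
    mat_trace ((A + B) * X) = mat_trace (A * X) + mat_trace (B * X)"
  by (simp add: add_mult_distrib_mat[of A n n B X n] trace_add[of _ n])

lemma trace_minus_mult:
  "A \<in> carrier_mat n n \<Longrightarrow> B \<in> carrier_mat n n \<Longrightarrow> X \<in> carrier_mat n n \<Longrightarrow>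
    mat_trace ((A - B) * X) = mat_trace (A * X) - mat_trace (B * X)"
  by (simp add: minus_mult_distrib_mat[of A n n B X n] trace_minus[of _ n])

lemma trace_smult_mult:
  "A \<in> carrier_mat n n \<Longrightarrow> X \<in> carrier_mat n n \<Longrightarrow> mat_trace ((c \<cdot>\<^sub>m A) * X) = c * mat_trace (A * X)"
  by (simp add: mult_smult_assoc_mat[of A n n X n] trace_smult[of _ n])

definition rank_one :: "nat \<Rightarrow> complex vec \<Rightarrow> complex mat" where
  "rank_one n v = mat n n (\<lambda>(i, j). v $ i * cnj (v $ j))"

lemma rank_one_carrier [simp]: "rank_one n v \<in> carrier_mat n n"
  by (simp add: rank_one_def)

lemma trace_rank_one:
  assumes "A \<in> carrier_mat n n" "v \<in> carrier_vec n"
  shows "mat_trace (A * rank_one n v) = (A *\<^sub>v v) \<bullet>c v"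
proof -
  have "mat_trace (A * rank_one n v) = (\<Sum>i<n. \<Sum>k<n. A $$ (i, k) * (v $ k * cnj (v $ i)))"
    using assms by (subst trace_mult[of _ n n]) (auto simp: rank_one_def)
  also have "\<dots> = (\<Sum>i<n. (A *\<^sub>v v) $ i * cnj (v $ i))"
    using assms by (intro sum.cong refl)
      (simp add: scalar_prod_def lessThan_atLeast0 sum_distrib_right mult.assoc)
  also have "\<dots> = (A *\<^sub>v v) \<bullet>c v"
    using assms by (simp add: cscalar_prod_sum[of v n])
  finally show ?thesis .
qed

text \<open>Written as a trace, the quadratic form is linear in \<open>A\<close> and can be moved
  through sums, partial traces and closed conditions.\<close>

lemma psd_iff_trace:
  "psd n A \<longleftrightarrow> A \<in> carrier_mat n n \<and> mat_adjoint A = A \<and>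
     (\<forall>v \<in> carrier_vec n. 0 \<le> Re (mat_trace (A * rank_one n v)))"
  unfolding psd_def by (auto simp: trace_rank_one)

lemma psd_carrier: "psd n A \<Longrightarrow> A \<in> carrier_mat n n"
  by (simp add: psd_def)

lemma psd_adjoint: "psd n A \<Longrightarrow> mat_adjoint A = A"
  by (simp add: psd_def)

lemma trace_spectral:
  assumes "U \<in> carrier_mat n n" "X \<in> carrier_mat n n"
  shows "mat_trace (spectral n U d * X) = (\<Sum>i<n. d i * (mat_adjoint U * X * U) $$ (i, i))"
proof -
  let ?D = "mat_diag n (\<lambda>i. complex_of_real (d i))"
  have "mat_trace (spectral n U d * X) = mat_trace (U * (?D * (mat_adjoint U * X)))"
    using assms by (simp add: spectral_def assoc_mult_mat[of _ n n _ n _ n])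
  also have "\<dots> = mat_trace ((?D * (mat_adjoint U * X)) * U)"
    using assms by (intro trace_comm[of _ n n]) auto
  also have "(?D * (mat_adjoint U * X)) * U = ?D * (mat_adjoint U * X * U)"
    using assms by (simp add: assoc_mult_mat[of _ n n _ n _ n])
  also have "mat_trace \<dots> = (\<Sum>i<n. d i * (mat_adjoint U * X * U) $$ (i, i))"
    using assms by (subst mat_diag_mult_left[of _ n n]) (auto simp: mat_trace_def)
  finally show ?thesis .
qed

lemma conj_index_rank_one:
  assumes "U \<in> carrier_mat n n" "A \<in> carrier_mat n n" "i < n"
  shows "(mat_adjoint U * A * U) $$ (i, i) = mat_trace (A * rank_one n (col U i))"
proof -
  have "(mat_adjoint U * A * U) $$ (i, i) = (mat_adjoint U * (A * U)) $$ (i, i)"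
    using assms by (simp add: assoc_mult_mat[of _ n n _ n _ n])
  also have "\<dots> = (\<Sum>k<n. cnj (U $$ (k, i)) * (A * U) $$ (k, i))"
    using assms by (subst index_mult_mat_sum[of _ n n _ n]) auto
  also have "\<dots> = (\<Sum>k<n. \<Sum>l<n. A $$ (k, l) * (U $$ (l, i) * cnj (U $$ (k, i))))"
    using assms by (intro sum.cong refl)
     (simp add: index_mult_mat_sum[of _ n n _ n] sum_distrib_left mult_ac del: index_mult_mat)
  also have "\<dots> = mat_trace (A * rank_one n (col U i))"
    using assms by (subst trace_mult[of _ n n]) (auto simp: rank_one_def)
  finally show ?thesis .
qed

lemma psd_spectral:
  assumes "unitary n U" "\<And>i. i < n \<Longrightarrow> 0 \<le> d i"
  shows "psd n (spectral n U d)"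
proof -
  note U = unitary_carrier[OF assms(1)]
  have "0 \<le> Re (mat_trace (spectral n U d * rank_one n v))" if v: "v \<in> carrier_vec n" for v
  proof -
    have "(mat_adjoint U * rank_one n v * U) $$ (i, i)
        = complex_of_real ((cmod (\<Sum>k<n. cnj (U $$ (k, i)) * v $ k))\<^sup>2)" if i: "i < n" for i
    proof -
      have "(mat_adjoint U * rank_one n v * U) $$ (i, i)
          = (\<Sum>l<n. (\<Sum>k<n. cnj (U $$ (k, i)) * (v $ k * cnj (v $ l))) * U $$ (l, i))"
        using U i by (subst index_mult_mat_sum[of _ n n _ n], simp_all del: index_mult_mat,
          intro sum.cong refl, subst index_mult_mat_sum[of _ n n _ n]) (auto simp: rank_one_def)
      also have "\<dots> = (\<Sum>k<n. cnj (U $$ (k, i)) * v $ k) * cnj (\<Sum>k<n. cnj (U $$ (k, i)) * v $ k)"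
        by (simp add: sum_distrib_left sum_distrib_right mult_ac)
      finally show ?thesis by (simp only: complex_norm_square)
    qed
    then have "mat_trace (spectral n U d * rank_one n v)
        = (\<Sum>i<n. complex_of_real (d i * (cmod (\<Sum>k<n. cnj (U $$ (k, i)) * v $ k))\<^sup>2))"
      using U by (subst trace_spectral) auto
    then show ?thesis using assms(2) by (auto intro!: sum_nonneg)
  qed
  then show ?thesis using U by (simp add: psd_iff_trace adjoint_spectral)
qed

lemma unitary_conj_spectral:
  assumes "unitary n U"
  shows "mat_adjoint U * spectral n U d * U = mat_diag n (\<lambda>i. complex_of_real (d i))"
proof -
  note U = unitary_carrier[OF assms]
  have "mat_adjoint U * spectral n U d * U
      = (mat_adjoint U * U) * (mat_diag n (\<lambda>i. complex_of_real (d i)) * (mat_adjoint U * U))"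
    using U unfolding spectral_def by (simp add: assoc_mult_mat[of _ n n _ n _ n])
  then show ?thesis
    using unitary_left[OF assms] by (simp add: left_mult_one_mat[of _ n n] right_mult_one_mat[of _ n n])
qed

theorem psd_spectralE:
  assumes "psd n A"
  obtains U d where "unitary n U" "A = spectral n U d" "\<And>i. i < n \<Longrightarrow> 0 \<le> d i"
proof -
  from hermitian_spectral[OF psd_carrier[OF assms] psd_adjoint[OF assms]]
  obtain U d where U: "unitary n U" and A: "A = spectral n U d" by auto
  note c = unitary_carrier[OF U]
  have "0 \<le> d i" if "i < n" for i
  proof -
    have "complex_of_real (d i) = (mat_adjoint U * A * U) $$ (i, i)"
      unfolding A unitary_conj_spectral[OF U] using that by (simp add: mat_diag_def)
    also have "\<dots> = mat_trace (A * rank_one n (col U i))"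
      using c psd_carrier[OF assms] that by (rule conj_index_rank_one)
    finally have "d i = Re (mat_trace (A * rank_one n (col U i)))" by (metis Re_complex_of_real)
    with assms that c show ?thesis by (simp add: psd_iff_trace)
  qed
  with U A show ?thesis using that by blast
qed

text \<open>In the eigenbases of \<open>P\<close> and \<open>N\<close> the trace is a sum of
  products of eigenvalues with squared moduli. The resolvent comparison uses it with an
  \<open>X\<close> that completes a square.\<close>

lemma trace_psd_conj_nonneg:
  assumes P: "psd n P" and N: "psd n N" and X: "X \<in> carrier_mat n n"
  shows "0 \<le> Re (mat_trace (P * (mat_adjoint X * (N * X))))"
proof -
  from P obtain U a where U: "unitary n U" "P = spectral n U a" "\<And>i. i < n \<Longrightarrow> 0 \<le> a i"
    by (rule psd_spectralE) blast
  from N obtain V b where V: "unitary n V" "N = spectral n V b" "\<And>i. i < n \<Longrightarrow> 0 \<le> b i"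
    by (rule psd_spectralE) blast
  have "0 \<le> Re (complex_of_real c * cnj z * z)" if "0 \<le> c" for c z
    using that by (simp add: mult.assoc complex_mult_cnj mult.commute[of "cnj z"] del: complex_cnj_mult)
  then show ?thesis
    unfolding U(2) V(2) trace_spectral_spectral[OF U(1) V(1) X X] Re_sum
    using U(3) V(3) by (intro sum_nonneg) auto
qed

lemma trace_psd_mult_nonneg:
  assumes "psd n P" "psd n N"
  shows "0 \<le> Re (mat_trace (P * N))"
  using trace_psd_conj_nonneg[OF assms, of "1\<^sub>m n"] psd_carrier[OF assms(1)] psd_carrier[OF assms(2)]
  by (simp add: left_mult_one_mat[of _ n n] right_mult_one_mat[of _ n n])

lemma psd_rank_one: assumes "v \<in> carrier_vec n" shows "psd n (rank_one n v)"
proof -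
  have "Re ((rank_one n v *\<^sub>v w) \<bullet>c w) \<ge> 0" if w: "w \<in> carrier_vec n" for w
  proof -
    have "(rank_one n v *\<^sub>v w) \<bullet>c w = (\<Sum>i<n. (\<Sum>j<n. v $ i * cnj (v $ j) * w $ j) * cnj (w $ i))"
      using w by (simp add: cscalar_prod_sum[OF w] scalar_prod_def lessThan_atLeast0 rank_one_def)
    also have "\<dots> = (\<Sum>i<n. v $ i * cnj (w $ i) * (\<Sum>j<n. cnj (v $ j) * w $ j))"
      by (simp add: sum_distrib_left sum_distrib_right mult_ac)
    also have "\<dots> = (\<Sum>i<n. v $ i * cnj (w $ i)) * cnj (\<Sum>i<n. v $ i * cnj (w $ i))"
      by (simp add: sum_distrib_right)
    also have "\<dots> = complex_of_real ((cmod (\<Sum>i<n. v $ i * cnj (w $ i)))\<^sup>2)"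
      by (simp only: complex_norm_square)
    finally show ?thesis by simp
  qed
  moreover have "mat_adjoint (rank_one n v) = rank_one n v"
    by (rule eq_matI) (auto simp: rank_one_def)
  ultimately show ?thesis by (simp add: psd_def)
qed

lemma psd_add:
  assumes "psd n A" "psd n B" shows "psd n (A + B)"
proof -
  note c = assms[THEN psd_carrier] and h = assms[THEN psd_adjoint]
  have "mat_adjoint (A + B) = mat_adjoint A + mat_adjoint B"
    using c by (intro eq_matI) auto
  then show ?thesis using assms c h
    by (auto simp: psd_iff_trace trace_add_mult)
qed

lemma psd_smult:
  assumes "psd n A" "0 \<le> c" shows "psd n (complex_of_real c \<cdot>\<^sub>m A)"
proof -
  note A = assms(1)[THEN psd_carrier] and h = assms(1)[THEN psd_adjoint]
  have "mat_adjoint (complex_of_real c \<cdot>\<^sub>m A) = complex_of_real c \<cdot>\<^sub>m mat_adjoint A"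
    using A by (intro eq_matI) auto
  then show ?thesis using assms A h
    by (auto simp: psd_iff_trace trace_smult_mult)
qed

section \<open>Logarithm of a matrix\<close>

text \<open>\<open>W\<close> intertwines the two diagonal matrices, so \<open>W $$ (i, j)\<close> is
  nonzero only where \<open>d j = e i\<close>, and there the values of \<open>f\<close> agree too.
  Hence \<open>W\<close> also intertwines the images under \<open>f\<close>. This gives the
  uniqueness behind the definite description in \<open>hermitian_fun\<close>.\<close>

lemma spectral_fun_unique:
  assumes U: "unitary n U" and V: "unitary n V" and eq: "spectral n U d = spectral n V e"
  shows "spectral n U (\<lambda>i. f (d i)) = spectral n V (\<lambda>i. f (e i))"
proof -
  note c = U[THEN unitary_carrier] V[THEN unitary_carrier]
  define D where "D d = mat_diag n (\<lambda>i. complex_of_real (d i))" for d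
  have D [simp]: "D d \<in> carrier_mat n n" for d by (simp add: D_def)
  have spec: "spectral n U d = U * (D d * mat_adjoint U)" if "U \<in> carrier_mat n n" for U d
    using that by (simp add: spectral_def D_def assoc_mult_mat[of _ n n _ n _ n])
  define W where "W = mat_adjoint V * U"
  have W: "W \<in> carrier_mat n n" using c by (simp add: W_def)
  have "W * D d = mat_adjoint V * (spectral n U d * U)"
    unfolding spec[OF c(1)] W_def
    using c by (simp add: assoc_mult_mat[of _ n n _ n _ n] unitary_left[OF U] right_mult_one_mat[of _ n n])
  also have "\<dots> = mat_adjoint V * (spectral n V e * U)" using eq by simp
  also have "\<dots> = (mat_adjoint V * V) * (D e * W)"
    unfolding spec[OF c(2)] W_def using c by (simp add: assoc_mult_mat[of _ n n _ n _ n])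
  also have "\<dots> = D e * W" using W by (simp add: unitary_left[OF V] left_mult_one_mat[of _ n n])
  finally have WD: "W * D d = D e * W" .
  have "W $$ (i, j) * f (d j) = f (e i) * W $$ (i, j)" if ij: "i < n" "j < n" for i j
  proof -
    have "(W * D d) $$ (i, j) = (D e * W) $$ (i, j)" using WD by simp
    then have "W $$ (i, j) * d j = e i * W $$ (i, j)"
      using ij W unfolding D_def by (simp add: mat_diag_mult_left[of _ n n] mat_diag_mult_right[of _ n n])
    then show ?thesis by (cases "W $$ (i, j) = 0") auto
  qed
  then have WF: "W * D (\<lambda>i. f (d i)) = D (\<lambda>i. f (e i)) * W"
    using W unfolding D_def mat_diag_mult_left[OF W] mat_diag_mult_right[OF W]
    by (intro cong_mat) auto
  have "spectral n U (\<lambda>i. f (d i)) = (V * mat_adjoint V) * (U * (D (\<lambda>i. f (d i)) * mat_adjoint U))"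
    using c by (simp add: spec unitary_right[OF V] left_mult_one_mat[of _ n n])
  also have "\<dots> = V * ((W * D (\<lambda>i. f (d i))) * mat_adjoint U)"
    using c by (simp add: W_def assoc_mult_mat[of _ n n _ n _ n])
  also have "\<dots> = V * (D (\<lambda>i. f (e i)) * (mat_adjoint V * (U * mat_adjoint U)))"
    unfolding WF using c by (simp add: W_def assoc_mult_mat[of _ n n _ n _ n])
  also have "\<dots> = spectral n V (\<lambda>i. f (e i))"
    using c by (simp add: spec unitary_right[OF U] right_mult_one_mat[of _ n n])
  finally show ?thesis .
qed

lemma hermitian_fun_spectral:
  assumes "unitary n U"
  shows "hermitian_fun f (spectral n U d) = spectral n U (\<lambda>i. f (d i))"
proof -
  have n: "dim_row (spectral n U d) = n" using unitary_carrier[OF assms] by simp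
  have "hermitian_fun f (spectral n U d) =
      (THE B. \<exists>V e. unitary n V \<and> spectral n U d = spectral n V e \<and> B = spectral n V (\<lambda>i. f (e i)))"
    unfolding hermitian_fun_def Let_def n unitary_def spectral_def[symmetric] conj_assoc ..
  also have "\<dots> = spectral n U (\<lambda>i. f (d i))"
  proof (rule the_equality)
    show "\<exists>V e. unitary n V \<and> spectral n U d = spectral n V e \<and>
        spectral n U (\<lambda>i. f (d i)) = spectral n V (\<lambda>i. f (e i))"
      using assms by blast
  next
    fix B assume "\<exists>V e. unitary n V \<and> spectral n U d = spectral n V e \<and> B = spectral n V (\<lambda>i. f (e i))"
    then obtain V e where "unitary n V" "spectral n U d = spectral n V e" "B = spectral n V (\<lambda>i. f (e i))"
      by blast
    then show "B = spectral n U (\<lambda>i. f (d i))"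
      using spectral_fun_unique[OF assms, of V d e f] by simp
  qed
  finally show ?thesis .
qed

text \<open>As \<open>ln 0 = 0\<close> in HOL, the case distinction at 0 disappears and later
  formulas carry plain \<open>ln\<close> even of vanishing eigenvalues.\<close>

lemma mat_log_spectral:
  assumes "unitary n U"
  shows "mat_log (spectral n U d) = spectral n U (\<lambda>i. ln (d i))"
  unfolding mat_log_def by (subst hermitian_fun_spectral[OF assms]) (rule spectral_cong, simp)

section \<open>Partial trace and its adjoint\<close>

lemma sum_mult_index:
  fixes f :: "nat \<Rightarrow> 'a::comm_monoid_add"
  shows "(\<Sum>r<a * b. f r) = (\<Sum>i<a. \<Sum>k<b. f (i * b + k))"
proof -
  have "(\<Sum>r<a * b. f r) = (\<Sum>i<a. sum f {i * b..<i * b + b})" by (rule sum.nat_group[symmetric])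
  also have "\<dots> = (\<Sum>i<a. \<Sum>k<b. f (i * b + k))"
  proof (rule sum.cong[OF refl])
    fix i
    show "sum f {i * b..<i * b + b} = (\<Sum>k<b. f (i * b + k))"
      by (rule sum.reindex_bij_witness[of _ "\<lambda>k. i * b + k" "\<lambda>r. r - i * b"]) auto
  qed
  finally show ?thesis .
qed

lemma mult_index_less:
  assumes "i < a" "k < b" shows "i * b + k < a * (b::nat)"
proof -
  have "i * b + k < (i + 1) * b" using assms(2) by simp
  also have "\<dots> \<le> a * b" using assms(1) by (intro mult_le_mono1) simp
  finally show ?thesis .
qed

lemma mult_index_eq_iff:
  assumes "k < b" "l < b" shows "i * b + k = j * b + l \<longleftrightarrow> i = j \<and> k = (l::nat)"
proof
  assume *: "i * b + k = j * b + l"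
  have "i = (i * b + k) div b" "j = (j * b + l) div b" using assms by simp_all
  with * show "i = j \<and> k = l" by simp
qed simp

lemma eq_mat_multI:
  assumes "A \<in> carrier_mat (a * b) (a * b)" "B \<in> carrier_mat (a * b) (a * b)"
    and "\<And>i k j l. i < a \<Longrightarrow> k < b \<Longrightarrow> j < a \<Longrightarrow> l < b \<Longrightarrow>
      A $$ (i * b + k, j * b + l) = B $$ (i * b + k, j * b + l)"
  shows "A = B"
proof (rule eq_matI)
  fix r s assume "r < dim_row B" "s < dim_col B"
  then have "r < a * b" "s < a * b" using assms by auto
  moreover from this have "0 < b" by (auto intro: gr0I)
  ultimately show "A $$ (r, s) = B $$ (r, s)"
    using assms(3)[of "r div b" "r mod b" "s div b" "s mod b"]
    by (simp add: less_mult_imp_div_less)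
qed (use assms in auto)

text \<open>\<open>Y\<close> tensored with the identity on B, in the index convention of
  \<open>ptrace_B\<close>.\<close>

definition kron_id :: "nat \<Rightarrow> nat \<Rightarrow> complex mat \<Rightarrow> complex mat" where
  "kron_id a b Y = mat (a * b) (a * b)
     (\<lambda>(r, s). if r mod b = s mod b then Y $$ (r div b, s div b) else 0)"

lemma kron_id_carrier [simp]: "kron_id a b Y \<in> carrier_mat (a * b) (a * b)"
  by (simp add: kron_id_def)

lemma kron_id_dim [simp]: "dim_row (kron_id a b Y) = a * b" "dim_col (kron_id a b Y) = a * b"
  by (simp_all add: kron_id_def)

lemma kron_id_index:
  "i < a \<Longrightarrow> k < b \<Longrightarrow> j < a \<Longrightarrow> l < b \<Longrightarrow>
    kron_id a b Y $$ (i * b + k, j * b + l) = (if k = l then Y $$ (i, j) else 0)"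
  by (simp add: kron_id_def mult_index_less)

lemma kron_id_one: "kron_id a b (1\<^sub>m a) = 1\<^sub>m (a * b)"
  by (rule eq_mat_multI) (auto simp: kron_id_index mult_index_less mult_index_eq_iff)

lemma kron_id_mult:
  assumes "Y \<in> carrier_mat a a" "Z \<in> carrier_mat a a"
  shows "kron_id a b Y * kron_id a b Z = kron_id a b (Y * Z)"
proof (rule eq_mat_multI)
  fix i k j l assume *: "i < a" "k < b" "j < a" "l < b"
  have "(kron_id a b Y * kron_id a b Z) $$ (i * b + k, j * b + l)
      = (\<Sum>p<a. \<Sum>q<b. (if k = q then Y $$ (i, p) else 0) * (if q = l then Z $$ (p, j) else 0))"
    using * by (subst index_mult_mat_sum[of _ "a * b" "a * b" _ "a * b"])
      (auto simp: sum_mult_index mult_index_less kron_id_index simp del: mult_eq_0_iff intro!: sum.cong)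
  also have "\<dots> = (\<Sum>p<a. \<Sum>q<b. if q = k then (if k = l then Y $$ (i, p) * Z $$ (p, j) else 0) else 0)"
    by (intro sum.cong refl) auto
  also have "\<dots> = kron_id a b (Y * Z) $$ (i * b + k, j * b + l)"
    using * assms by (simp add: kron_id_index index_mult_mat_sum[of _ a a _ a] del: index_mult_mat)
  finally show "(kron_id a b Y * kron_id a b Z) $$ (i * b + k, j * b + l)
    = kron_id a b (Y * Z) $$ (i * b + k, j * b + l)" .
qed auto

lemma kron_id_adjoint:
  assumes "Y \<in> carrier_mat a a"
  shows "mat_adjoint (kron_id a b Y) = kron_id a b (mat_adjoint Y)"
  using assms kron_id_carrier[of a b Y]
  by (intro eq_mat_multI[of _ a b]) (auto simp: kron_id_index mult_index_less)

lemma ptrace_carrier [simp]: "ptrace_B a b X \<in> carrier_mat a a"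
  by (simp add: ptrace_B_def)

text \<open>Adjointness of the partial trace and of tensoring with the identity; it carries trace
  conditions between A and AB in both directions.\<close>

lemma trace_kron_id_mult:
  assumes "Y \<in> carrier_mat a a" "X \<in> carrier_mat (a * b) (a * b)"
  shows "mat_trace (kron_id a b Y * X) = mat_trace (Y * ptrace_B a b X)"
proof -
  have "mat_trace (kron_id a b Y * X) = (\<Sum>i<a. \<Sum>k<b. \<Sum>j<a. \<Sum>l<b.
      (if k = l then Y $$ (i, j) else 0) * X $$ (j * b + l, i * b + k))"
    using assms by (subst trace_mult[of _ "a * b" "a * b"])
      (auto simp: sum_mult_index kron_id_index simp del: mult_eq_0_iff intro!: sum.cong)
  also have "\<dots> = (\<Sum>i<a. \<Sum>k<b. \<Sum>j<a. \<Sum>l<b.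
      if l = k then Y $$ (i, j) * X $$ (j * b + k, i * b + k) else 0)"
    by (intro sum.cong refl) auto
  also have "\<dots> = (\<Sum>i<a. \<Sum>k<b. \<Sum>j<a. Y $$ (i, j) * X $$ (j * b + k, i * b + k))"
    by (intro sum.cong refl) simp
  also have "\<dots> = (\<Sum>i<a. \<Sum>j<a. \<Sum>k<b. Y $$ (i, j) * X $$ (j * b + k, i * b + k))"
    by (intro sum.cong refl sum.swap)
  also have "\<dots> = mat_trace (Y * ptrace_B a b X)"
    using assms by (subst trace_mult[of _ a a]) (auto simp: ptrace_B_def sum_distrib_left)
  finally show ?thesis .
qed

lemma trace_ptrace:
  assumes "X \<in> carrier_mat (a * b) (a * b)"
  shows "mat_trace (ptrace_B a b X) = mat_trace X"
  using assms by (simp add: mat_trace_def ptrace_B_def sum_mult_index)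

lemma psd_one: "psd n (1\<^sub>m n)"
  using psd_spectral[OF unitary_one[of n], of "\<lambda>_. 1"] by (simp add: spectral_one)

lemma psd_adjoint_mult:
  assumes S: "S \<in> carrier_mat n n" shows "psd n (mat_adjoint S * S)"
proof -
  have "Re (mat_trace (mat_adjoint S * S * rank_one n v)) \<ge> 0" if v: "v \<in> carrier_vec n" for v
  proof -
    have "mat_trace (mat_adjoint S * S * rank_one n v)
        = mat_trace (rank_one n v * (mat_adjoint S * (1\<^sub>m n * S)))"
      using S by (subst trace_comm[of _ n n]) (auto simp: left_mult_one_mat[of _ n n])
    then show ?thesis using trace_psd_conj_nonneg[OF psd_rank_one[OF v] psd_one S] by simp
  qed
  then show ?thesis using S by (simp add: psd_iff_trace adjoint_mult[of _ n n _ n])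
qed

text \<open>A square root of \<open>Y\<close> exists spectrally and \<open>kron_id\<close> respects
  products and adjoints, so the image is again an adjoint times its matrix.\<close>

lemma psd_kron_id:
  assumes "psd a Y" shows "psd (a * b) (kron_id a b Y)"
proof -
  from assms obtain U d where U: "unitary a U" "Y = spectral a U d" "\<And>i. i < a \<Longrightarrow> 0 \<le> d i"
    by (rule psd_spectralE) blast
  note c = unitary_carrier[OF U(1)]
  let ?S = "spectral a U (\<lambda>i. sqrt (d i))"
  have "Y = ?S * ?S" unfolding spectral_mult[OF U(1)] U(2) by (rule spectral_cong) (simp add: U(3))
  then have "kron_id a b Y = mat_adjoint (kron_id a b ?S) * kron_id a b ?S"
    using c by (simp add: kron_id_adjoint kron_id_mult adjoint_spectral)
  then show ?thesis by (simp add: psd_adjoint_mult)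
qed

text \<open>By adjointness, testing the partial trace on \<open>rank_one a v\<close> means testing
  \<open>X\<close> on the positive matrix \<open>kron_id a b (rank_one a v)\<close>.\<close>

lemma psd_ptrace:
  assumes "psd (a * b) X" shows "psd a (ptrace_B a b X)"
proof -
  note X = psd_carrier[OF assms]
  have h: "cnj (X $$ (r, s)) = X $$ (s, r)" if "r < a * b" "s < a * b" for r s
    using adjoint_index[of s X r] psd_adjoint[OF assms] X that by simp
  have "mat_adjoint (ptrace_B a b X) = ptrace_B a b X"
    by (rule eq_matI) (auto simp: ptrace_B_def h mult_index_less)
  moreover have "0 \<le> Re (mat_trace (ptrace_B a b X * rank_one a v))" if v: "v \<in> carrier_vec a" for v
  proof -
    have "mat_trace (ptrace_B a b X * rank_one a v) = mat_trace (kron_id a b (rank_one a v) * X)"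
      using X by (subst trace_comm[of _ a a]) (auto simp: trace_kron_id_mult)
    then show ?thesis
      using trace_psd_mult_nonneg[OF psd_kron_id[OF psd_rank_one[OF v]] assms] by simp
  qed
  ultimately show ?thesis by (simp add: psd_iff_trace)
qed

section \<open>Resolvent comparison\<close>

text \<open>The logarithm of x is the integral of 1/(1 + t) - 1/(x + t) over t \<ge> 0. Monotonicity
  stands in for the integral: \<open>F\<close> has nonpositive derivative and tends to 0 at
  infinity, hence \<open>F 0\<close> is nonnegative.\<close>

lemma sum_ln_le_of_resolvent:
  fixes m w :: "'a \<Rightarrow> real" and n v :: "'b \<Rightarrow> real"
  assumes I: "finite I" "\<And>i. i \<in> I \<Longrightarrow> 0 < w i" and J: "finite J" "\<And>j. j \<in> J \<Longrightarrow> 0 < v j"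
    and mass: "(\<Sum>i\<in>I. m i) = (\<Sum>j\<in>J. n j)"
    and resolvent: "\<And>t. 0 \<le> t \<Longrightarrow> (\<Sum>j\<in>J. n j / (v j + t)) \<le> (\<Sum>i\<in>I. m i / (w i + t))"
  shows "(\<Sum>i\<in>I. m i * ln (w i)) \<le> (\<Sum>j\<in>J. n j * ln (v j))"
proof -
  define F where "F t = (\<Sum>j\<in>J. n j * ln (v j + t)) - (\<Sum>i\<in>I. m i * ln (w i + t))" for t
  have deriv: "(F has_real_derivative ((\<Sum>j\<in>J. n j / (v j + t)) - (\<Sum>i\<in>I. m i / (w i + t)))) (at t)"
    if "0 \<le> t" for t
    unfolding F_def using that I J
    by (auto intro!: derivative_eq_intros sum.cong simp: add_pos_nonneg)
  have anti: "F t \<le> F 0" if "0 \<le> t" for t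
    using that
  proof (rule DERIV_nonpos_imp_nonincreasing)
    fix x assume "0 \<le> x" "x \<le> t"
    then show "\<exists>y. (F has_real_derivative y) (at x) \<and> y \<le> 0"
      using deriv[of x] resolvent[of x] by (intro exI conjI) auto
  qed
  have lim0: "((\<lambda>t. ln (1 + c / t)) \<longlongrightarrow> 0) at_top" for c :: real
  proof -
    have "((\<lambda>t. c / t) \<longlongrightarrow> 0) at_top"
      by (rule tendsto_divide_0[OF tendsto_const filterlim_mono[OF filterlim_ident at_top_le_at_infinity order_refl]])
    then have "((\<lambda>t. ln (1 + c / t)) \<longlongrightarrow> ln (1 + 0)) at_top"
      by (intro tendsto_intros) auto
    then show ?thesis by simp
  qed
  have "((\<lambda>t. (\<Sum>j\<in>J. n j * ln (1 + v j / t)) - (\<Sum>i\<in>I. m i * ln (1 + w i / t)))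
      \<longlongrightarrow> (\<Sum>j\<in>J. n j * 0) - (\<Sum>i\<in>I. m i * 0)) at_top"
    by (intro tendsto_intros lim0)
  moreover have "eventually (\<lambda>t. (\<Sum>j\<in>J. n j * ln (1 + v j / t)) - (\<Sum>i\<in>I. m i * ln (1 + w i / t)) = F t) at_top"
    using eventually_gt_at_top[of "0::real"]
  proof eventually_elim
    case (elim t)
    \<comment> \<open>Splitting off the divergent \<open>ln t\<close> is where equal total mass
      matters: these terms cancel between the two sums.\<close>
    have s: "ln (c + t) = ln t + ln (1 + c / t)" if "0 < c" for c
    proof -
      have "c + t = t * (1 + c / t)" using elim by (simp add: field_simps)
      moreover have "0 < 1 + c / t" using elim that by (simp add: add_pos_pos)
      ultimately show ?thesis using elim by (simp add: ln_mult_pos)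
    qed
    have "F t = (\<Sum>j\<in>J. n j * (ln t + ln (1 + v j / t))) - (\<Sum>i\<in>I. m i * (ln t + ln (1 + w i / t)))"
      unfolding F_def using I J by (simp add: s)
    then show ?case
      by (simp add: distrib_left sum.distrib sum_distrib_right[symmetric] mass)
  qed
  ultimately have "(F \<longlongrightarrow> 0) at_top"
    by (simp add: Lim_transform_eventually)
  then have "0 \<le> F 0"
    by (rule tendsto_upperbound[OF _ eventually_mono[OF eventually_ge_at_top[of 0] anti] trivial_limit_at_top_linorder])
  then show ?thesis by (simp add: F_def)
qed

definition mat_sum :: "nat \<Rightarrow> 'a set \<Rightarrow> ('a \<Rightarrow> complex mat) \<Rightarrow> complex mat" where
  "mat_sum n J N = mat n n (\<lambda>ij. \<Sum>j\<in>J. N j $$ ij)"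

lemma mat_sum_carrier [simp]: "mat_sum n J N \<in> carrier_mat n n"
  by (simp add: mat_sum_def)

lemma trace_mat_sum_mult:
  assumes "\<And>j. j \<in> J \<Longrightarrow> N j \<in> carrier_mat n n" "X \<in> carrier_mat n n"
  shows "mat_trace (mat_sum n J N * X) = (\<Sum>j\<in>J. mat_trace (N j * X))"
proof -
  have "mat_trace (mat_sum n J N * X) = (\<Sum>i<n. \<Sum>k<n. \<Sum>j\<in>J. N j $$ (i, k) * X $$ (k, i))"
    using assms by (subst trace_mult[of _ n n]) (auto simp: mat_sum_def sum_distrib_right)
  also have "\<dots> = (\<Sum>j\<in>J. \<Sum>i<n. \<Sum>k<n. N j $$ (i, k) * X $$ (k, i))"
    by (simp only: sum.swap[of _ J])
  also have "\<dots> = (\<Sum>j\<in>J. mat_trace (N j * X))"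
    using assms by (intro sum.cong refl trace_mult[symmetric]) auto
  finally show ?thesis .
qed

lemma Re_trace_spectral:
  assumes "U \<in> carrier_mat n n" "X \<in> carrier_mat n n"
  shows "Re (mat_trace (spectral n U d * X)) = (\<Sum>i<n. Re ((mat_adjoint U * X * U) $$ (i, i)) * d i)"
  using assms by (subst trace_spectral) (auto simp: mult.commute)

lemma psd_conj_index_nonneg:
  assumes "psd n A" "U \<in> carrier_mat n n" "i < n"
  shows "0 \<le> Re ((mat_adjoint U * A * U) $$ (i, i))"
  using conj_index_rank_one[OF assms(2) psd_carrier[OF assms(1)] assms(3)] assms
  by (simp add: psd_iff_trace)

text \<open>Every term of the expansion is rotated so that \<open>N\<close> stands first; summed
  over outcomes, the terms then involve only sums of the \<open>N j\<close>, with or without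
  weights.\<close>

lemma trace_conj_one_minus_smult:
  assumes R: "R \<in> carrier_mat n n" and N: "N \<in> carrier_mat n n" and G: "G \<in> carrier_mat n n"
  shows "mat_trace (R * ((1\<^sub>m n - c \<cdot>\<^sub>m G) * (N * (1\<^sub>m n - c \<cdot>\<^sub>m G)))) =
    mat_trace (N * R) - c * mat_trace (N * (G * R)) - c * mat_trace (N * (R * G)) + c\<^sup>2 * mat_trace (N * (G * (R * G)))"
proof -
  let ?X = "1\<^sub>m n - c \<cdot>\<^sub>m G"
  have X: "?X \<in> carrier_mat n n" using G by (intro minus_carrier_mat) simp
  have ex: "mat_trace (?X * Q) = mat_trace Q - c * mat_trace (G * Q)" if "Q \<in> carrier_mat n n" for Q
    using G that by (simp add: trace_minus_mult[of _ n] trace_smult_mult[of _ n] left_mult_one_mat[of _ n n])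
  have comm: "mat_trace (A * B) = mat_trace (B * A)" if "A \<in> carrier_mat n n" "B \<in> carrier_mat n n" for A B
    using that by (rule trace_comm)
  note assoc = assoc_mult_mat[of _ n n _ n _ n]
  have "mat_trace (R * (?X * (N * ?X))) = mat_trace (?X * ((N * ?X) * R))"
    using R N X by (subst comm) (simp_all add: assoc)
  also have "\<dots> = mat_trace ((N * ?X) * R) - c * mat_trace (G * ((N * ?X) * R))"
    using R N X by (intro ex) simp
  also have "mat_trace ((N * ?X) * R) = mat_trace (?X * (R * N))"
    using R N X comm[of N "?X * R"] by (simp add: assoc)
  also have "\<dots> = mat_trace (R * N) - c * mat_trace (G * (R * N))"
    using R N by (intro ex) simp
  also have "mat_trace (G * ((N * ?X) * R)) = mat_trace (?X * (R * (G * N)))"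
    using R N X G comm[of "G * N" "?X * R"] by (simp add: assoc)
  also have "\<dots> = mat_trace (R * (G * N)) - c * mat_trace (G * (R * (G * N)))"
    using R N G by (intro ex) simp
  also have "mat_trace (R * N) = mat_trace (N * R)" using R N by (rule comm)
  also have "mat_trace (G * (R * N)) = mat_trace (N * (G * R))"
    using R N G comm[of "G * R" N] by (simp add: assoc)
  also have "mat_trace (R * (G * N)) = mat_trace (N * (R * G))"
    using R N G comm[of "R * G" N] by (simp add: assoc)
  also have "mat_trace (G * (R * (G * N))) = mat_trace (N * (G * (R * G)))"
    using R N G comm[of "G * (R * G)" N] by (simp add: assoc)
  finally show ?thesis by (simp add: algebra_simps power2_eq_square)
qed

text \<open>Operator concavity and monotonicity of the logarithm in one stroke. With \<Omega> the
  weighted sum of the \<open>N j\<close> and Z the dominating operator, the underlying chain is sum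
  N j / (w j + t) \<ge> 1/(\<Omega> + t) \<ge> 1/(Z + t). Using the resolvent of Z itself as test
  operator gives the outer inequality directly, without inverting \<Omega> + t.\<close>

lemma sum_log_measurement_le:
  assumes N: "\<And>j. j \<in> J \<Longrightarrow> psd (a * b) (N j)" and J: "finite J" and w: "\<And>j. j \<in> J \<Longrightarrow> 0 < w j"
    and one: "mat_sum (a * b) J N = 1\<^sub>m (a * b)"
    and \<rho>: "psd (a * b) \<rho>" and E: "unitary a E" and y: "\<And>l. l < a \<Longrightarrow> 0 < y l"
    and dom: "psd (a * b) (kron_id a b (spectral a E y) - mat_sum (a * b) J (\<lambda>j. complex_of_real (w j) \<cdot>\<^sub>m N j))"
  shows "(\<Sum>j\<in>J. Re (mat_trace (N j * \<rho>)) * ln (w j))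
    \<le> Re (mat_trace (spectral a E (\<lambda>l. ln (y l)) * ptrace_B a b \<rho>))"
proof -
  define n where "n = a * b"
  note N = N[folded n_def] and one = one[folded n_def] and \<rho> = \<rho>[folded n_def] and dom = dom[folded n_def]
  define p where "p l = Re ((mat_adjoint E * ptrace_B a b \<rho> * E) $$ (l, l))" for l
  note Ec = unitary_carrier[OF E]
  note Nc = N[THEN psd_carrier] and \<rho>c = \<rho>[THEN psd_carrier]
  have tr_one: "(\<Sum>j\<in>J. mat_trace (N j * X)) = mat_trace X" if "X \<in> carrier_mat n n" for X
    using trace_mat_sum_mult[of J N n X] Nc that unfolding one by (simp add: left_mult_one_mat[of _ n n])
  have tr_kron: "Re (mat_trace (kron_id a b (spectral a E d) * \<rho>)) = (\<Sum>l<a. p l * d l)" for d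
    unfolding p_def using Ec \<rho>c
    by (subst trace_kron_id_mult) (auto simp: n_def Re_trace_spectral)
  have "(\<Sum>j\<in>J. Re (mat_trace (N j * \<rho>)) * ln (w j)) \<le> (\<Sum>l<a. p l * ln (y l))"
  proof (rule sum_ln_le_of_resolvent)
    have "(\<Sum>j\<in>J. Re (mat_trace (N j * \<rho>))) = Re (mat_trace \<rho>)"
      using tr_one[OF \<rho>c] by (simp flip: Re_sum)
    also have "\<dots> = Re (mat_trace (kron_id a b (spectral a E (\<lambda>_. 1)) * \<rho>))"
      using \<rho>c unfolding spectral_one[OF E] kron_id_one n_def[symmetric] by (simp add: left_mult_one_mat[of _ n n])
    also have "\<dots> = (\<Sum>l<a. p l)" by (simp add: tr_kron)
    finally show "(\<Sum>j\<in>J. Re (mat_trace (N j * \<rho>))) = (\<Sum>l<a. p l)" .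
  next
    fix t :: real assume t: "0 \<le> t"
    \<comment> \<open>\<open>G\<close> is the inverse of Z + t on AB, the common test operator for
      all outcomes.\<close>
    define G where "G = kron_id a b (spectral a E (\<lambda>l. 1 / (y l + t)))"
    define Z where "Z = kron_id a b (spectral a E y)"
    define \<Omega> where "\<Omega> = mat_sum n J (\<lambda>j. complex_of_real (w j) \<cdot>\<^sub>m N j)"
    have G: "G \<in> carrier_mat n n" and Z: "Z \<in> carrier_mat n n" and \<Omega>: "\<Omega> \<in> carrier_mat n n"
      by (simp_all add: G_def Z_def \<Omega>_def n_def)
    have Gadj: "mat_adjoint G = G" using Ec by (simp add: G_def kron_id_adjoint adjoint_spectral)
    define K where "K = G * (\<rho> * G)"
    have K: "K \<in> carrier_mat n n" using G \<rho>c by (simp add: K_def)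
    \<comment> \<open>This is 1/c \<ge> 2 G - c G^2 with c = \<open>w j + t\<close>, in a form that
      allows for noncommuting factors: expand 0 \<le> tr \<rho> (1 - c G) N (1 - c G) for N =
      \<open>N j\<close> and divide by c.\<close>
    have GG: "Re (mat_trace (N j * (G * \<rho>))) + Re (mat_trace (N j * (\<rho> * G)))
        - Re (mat_trace ((complex_of_real (w j) \<cdot>\<^sub>m N j) * K)) - t * Re (mat_trace (N j * K))
        \<le> Re (mat_trace (N j * \<rho>)) / (w j + t)" if j: "j \<in> J" for j
    proof -
      define c where "c = w j + t"
      have c: "0 < c" using w[OF j] t by (simp add: c_def)
      let ?X = "1\<^sub>m n - complex_of_real c \<cdot>\<^sub>m G"
      have X: "?X \<in> carrier_mat n n" using G by (intro minus_carrier_mat) simp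
      have "cnj (G $$ (r, s)) = G $$ (s, r)" if "r < n" "s < n" for r s
        using adjoint_index[of s G r] Gadj G that by simp
      then have "mat_adjoint ?X = ?X" using G by (intro eq_matI) auto
      then have "0 \<le> Re (mat_trace (\<rho> * (?X * (N j * ?X))))"
        using trace_psd_conj_nonneg[OF \<rho> N[OF j] X] by simp
      also have "\<dots> = Re (mat_trace (N j * \<rho>)) - c * Re (mat_trace (N j * (G * \<rho>)))
          - c * Re (mat_trace (N j * (\<rho> * G))) + c\<^sup>2 * Re (mat_trace (N j * K))"
        unfolding trace_conj_one_minus_smult[OF \<rho>c Nc[OF j] G] K_def
        by (simp flip: of_real_power)
      finally have "c * (Re (mat_trace (N j * (G * \<rho>))) + Re (mat_trace (N j * (\<rho> * G)))
          - c * Re (mat_trace (N j * K))) \<le> Re (mat_trace (N j * \<rho>))"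
        by (simp add: algebra_simps power2_eq_square)
      then have "Re (mat_trace (N j * (G * \<rho>))) + Re (mat_trace (N j * (\<rho> * G)))
          - c * Re (mat_trace (N j * K)) \<le> Re (mat_trace (N j * \<rho>)) / c"
        using c by (simp add: pos_le_divide_eq mult.commute)
      then show ?thesis
        using Nc[OF j] K by (simp add: c_def trace_smult_mult[of _ n] algebra_simps)
    qed
    have cyc: "mat_trace (A * K) = mat_trace ((G * (A * G)) * \<rho>)" if "A \<in> carrier_mat n n" for A
    proof -
      have "mat_trace (A * K) = mat_trace ((A * G) * (\<rho> * G))"
        unfolding K_def using that G \<rho>c by (simp add: assoc_mult_mat[of _ n n _ n _ n])
      also have "\<dots> = mat_trace ((\<rho> * G) * (A * G))" using that G \<rho>c by (intro trace_comm[of _ n n]) auto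
      also have "\<dots> = mat_trace (\<rho> * (G * (A * G)))" using that G \<rho>c by (simp add: assoc_mult_mat[of _ n n _ n _ n])
      also have "\<dots> = mat_trace ((G * (A * G)) * \<rho>)" using that G \<rho>c by (intro trace_comm[of _ n n]) auto
      finally show ?thesis .
    qed
    have tG: "mat_trace (\<rho> * G) = mat_trace (G * \<rho>)" using \<rho>c G by (rule trace_comm)
    have \<Omega>Z: "Re (mat_trace (\<Omega> * K)) \<le> Re (mat_trace (Z * K))"
    proof -
      have "0 \<le> Re (mat_trace (\<rho> * (mat_adjoint G * ((Z - \<Omega>) * G))))"
        using trace_psd_conj_nonneg[OF \<rho> dom G] unfolding Z_def \<Omega>_def .
      also have "mat_trace (\<rho> * (mat_adjoint G * ((Z - \<Omega>) * G))) = mat_trace ((G * ((Z - \<Omega>) * G)) * \<rho>)"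
        unfolding Gadj using \<rho>c G Z \<Omega> by (intro trace_comm[of _ n n]) (auto simp: minus_carrier_mat)
      also have "\<dots> = mat_trace ((Z - \<Omega>) * K)"
        using Z \<Omega> by (subst cyc) (auto simp: minus_carrier_mat)
      also have "\<dots> = mat_trace (Z * K) - mat_trace (\<Omega> * K)"
        using Z \<Omega> K by (rule trace_minus_mult)
      finally show ?thesis by simp
    qed
    have ZK: "Re (mat_trace (Z * K)) = (\<Sum>l<a. p l * (y l / (y l + t)\<^sup>2))"
    proof -
      have "G * (Z * G) = kron_id a b (spectral a E (\<lambda>l. y l / (y l + t)\<^sup>2))"
        unfolding G_def Z_def using Ec
        by (simp add: kron_id_mult spectral_mult[OF E] power2_eq_square)
      then show ?thesis using cyc[OF Z] tr_kron by simp
    qed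
    have K1: "Re (mat_trace K) = (\<Sum>l<a. p l * (1 / (y l + t)\<^sup>2))"
    proof -
      have "G * G = kron_id a b (spectral a E (\<lambda>l. 1 / (y l + t)\<^sup>2))"
        unfolding G_def using Ec by (simp add: kron_id_mult spectral_mult[OF E] power2_eq_square)
      moreover have "mat_trace K = mat_trace ((G * G) * \<rho>)"
        using cyc[of "1\<^sub>m n"] K G by (simp add: left_mult_one_mat[of _ n n])
      ultimately show ?thesis using tr_kron by simp
    qed
    \<comment> \<open>Because G (Z + t) G = G, the quadratic bound is tight at Z: twice the trace of
      G \<rho> minus the quadratic part gives that trace back.\<close>
    have "(\<Sum>l<a. p l / (y l + t)) = 2 * (\<Sum>l<a. p l * (1 / (y l + t)))
        - (\<Sum>l<a. p l * (y l / (y l + t)\<^sup>2)) - t * (\<Sum>l<a. p l * (1 / (y l + t)\<^sup>2))"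
      unfolding sum_distrib_left sum_subtractf[symmetric]
    proof (intro sum.cong refl)
      fix l assume "l \<in> {..<a}"
      then have "0 < y l + t" using y[of l] t by simp
      then show "p l / (y l + t) = 2 * (p l * (1 / (y l + t))) - p l * (y l / (y l + t)\<^sup>2) - t * (p l * (1 / (y l + t)\<^sup>2))"
        by (simp add: divide_simps power2_eq_square) (simp add: algebra_simps)
    qed
    also have "\<dots> = 2 * Re (mat_trace (G * \<rho>)) - Re (mat_trace (Z * K)) - t * Re (mat_trace K)"
      unfolding ZK K1 G_def by (simp add: tr_kron)
    also have "\<dots> \<le> 2 * Re (mat_trace (G * \<rho>)) - Re (mat_trace (\<Omega> * K)) - t * Re (mat_trace K)"
      using \<Omega>Z by simp
    also have "\<dots> = (\<Sum>j\<in>J. Re (mat_trace (N j * (G * \<rho>))) + Re (mat_trace (N j * (\<rho> * G)))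
        - Re (mat_trace ((complex_of_real (w j) \<cdot>\<^sub>m N j) * K)) - t * Re (mat_trace (N j * K)))"
      using tr_one[of "G * \<rho>"] tr_one[of "\<rho> * G"] tr_one[OF K] G \<rho>c Nc K
      by (simp add: sum.distrib sum_subtractf \<Omega>_def trace_mat_sum_mult tG flip: Re_sum sum_distrib_left)
    also have "\<dots> \<le> (\<Sum>j\<in>J. Re (mat_trace (N j * \<rho>)) / (w j + t))"
      by (intro sum_mono GG)
    finally show "(\<Sum>l<a. p l / (y l + t)) \<le> (\<Sum>j\<in>J. Re (mat_trace (N j * \<rho>)) / (w j + t))" .
  qed (use J w y in auto)
  also have "\<dots> = Re (mat_trace (spectral a E (\<lambda>l. ln (y l)) * ptrace_B a b \<rho>))"
    unfolding p_def using Ec by (simp add: Re_trace_spectral)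
  finally show ?thesis .
qed

section \<open>Relative entropy in two eigenbases and its variational bound\<close>

lemma trace_spectral_mult_spectral:
  assumes U: "unitary n U" and V: "unitary n V" and X: "X \<in> carrier_mat n n" and Z: "Z \<in> carrier_mat n n"
  shows "Re (mat_trace (spectral n U a * (mat_adjoint X * (spectral n V b * Z)))) =
    (\<Sum>(i, k)\<in>{..<n} \<times> {..<n}. a i * b k *
      Re (cnj ((mat_adjoint V * X * U) $$ (k, i)) * (mat_adjoint V * Z * U) $$ (k, i)))"
  by (simp add: trace_spectral_spectral[OF assms] sum.cartesian_product mult.assoc case_prod_unfold)

text \<open>The squared overlaps of eigenvectors turn the entropy into a classical one on pairs (i,
  k), comparing the weights p_i |c_ki|^2 and q_k |c_ki|^2 (the Nussbaum-Szkola
  distributions).\<close>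

lemma spectral_relative_entropy:
  assumes U: "unitary n U" and V: "unitary n V"
  shows "Re (mat_trace (spectral n U p * (mat_log (spectral n U p) - mat_log (spectral n V q)))) =
    (\<Sum>(i, k)\<in>{..<n} \<times> {..<n}. p i * (ln (p i) - ln (q k)) * (cmod ((mat_adjoint V * U) $$ (k, i)))\<^sup>2)"
proof -
  note c = U[THEN unitary_carrier] V[THEN unitary_carrier]
  let ?S = "spectral n U p" and ?C = "mat_adjoint V * U"
  have s: "mat_adjoint V * 1\<^sub>m n * U = ?C" using c by (simp add: right_mult_one_mat[of _ n n])
  have sq: "Re (cnj z * z) = (cmod z)\<^sup>2" for z
    by (metis Re_complex_of_real complex_norm_square mult.commute)
  have "mat_trace (?S * (mat_log ?S - mat_log (spectral n V q)))
      = mat_trace (?S * spectral n U (\<lambda>i. ln (p i))) - mat_trace (?S * spectral n V (\<lambda>i. ln (q i)))"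
    unfolding mat_log_spectral[OF U] mat_log_spectral[OF V]
    using c by (subst mult_minus_distrib_mat[of _ n n _ n]) (auto simp: trace_minus[of _ n])
  also have "?S * spectral n U (\<lambda>i. ln (p i)) = spectral n U (\<lambda>i. p i * ln (p i)) * (mat_adjoint (1\<^sub>m n) * (spectral n V (\<lambda>_. 1) * 1\<^sub>m n))"
    using c by (simp add: spectral_mult[OF U] spectral_one[OF V] right_mult_one_mat[of _ n n] left_mult_one_mat[of _ n n])
  also have "?S * spectral n V (\<lambda>i. ln (q i)) = ?S * (mat_adjoint (1\<^sub>m n) * (spectral n V (\<lambda>i. ln (q i)) * 1\<^sub>m n))"
    using c by (simp add: right_mult_one_mat[of _ n n] left_mult_one_mat[of _ n n])
  finally have eq: "mat_trace (?S * (mat_log ?S - mat_log (spectral n V q)))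
      = mat_trace (spectral n U (\<lambda>i. p i * ln (p i)) * (mat_adjoint (1\<^sub>m n) * (spectral n V (\<lambda>_. 1) * 1\<^sub>m n)))
        - mat_trace (?S * (mat_adjoint (1\<^sub>m n) * (spectral n V (\<lambda>i. ln (q i)) * 1\<^sub>m n)))" .
  show ?thesis
    unfolding eq minus_complex.sel trace_spectral_mult_spectral[OF U V one_carrier_mat one_carrier_mat] s sq
      sum_subtractf[symmetric]
    by (simp add: case_prod_unfold left_diff_distrib right_diff_distrib)
qed

text \<open>The proof passes through the eigenbasis \<open>E\<close> of the test operator. A
  resolvent comparison shows that measuring in \<open>E\<close> does not increase the relative
  entropy, and the classical inequality ln u \<le> u - 1 treats the resulting diagonals
  \<open>P\<close> and \<open>Q\<close>. The pairs (i, k) diagonalise the relative modular operator: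
  \<open>q k / p i\<close> are its eigenvalues and \<open>m\<close> is its spectral
  distribution.\<close>

lemma log_variational_le_relative_entropy:
  assumes U: "unitary n U" and V: "unitary n V" and E: "unitary n E"
    and p: "\<And>i. i < n \<Longrightarrow> 0 \<le> p i" and q: "\<And>k. k < n \<Longrightarrow> 0 \<le> q k"
    and y: "\<And>j. j < n \<Longrightarrow> 0 < y j"
    and tr: "mat_trace (spectral n U p) = 1"
    and supp: "\<And>i k. i < n \<Longrightarrow> k < n \<Longrightarrow> p i \<noteq> 0 \<Longrightarrow> q k = 0 \<Longrightarrow> (mat_adjoint V * U) $$ (k, i) = 0"
  shows "Re (mat_trace (spectral n E (\<lambda>j. ln (y j)) * spectral n U p)) + 1
      - Re (mat_trace (spectral n E y * spectral n V q))
    \<le> Re (mat_trace (spectral n U p * (mat_log (spectral n U p) - mat_log (spectral n V q))))"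
    (is "?L \<le> ?R")
proof -
  note c = U[THEN unitary_carrier] V[THEN unitary_carrier] E[THEN unitary_carrier]
  define C where "C = mat_adjoint V * U"
  define P where "P j = Re ((mat_adjoint E * spectral n U p * E) $$ (j, j))" for j
  define Q where "Q j = Re ((mat_adjoint E * spectral n V q * E) $$ (j, j))" for j
  let ?I = "{..<n} \<times> {..<n}"
  define m where "m = (\<lambda>(i, k). p i * (cmod (C $$ (k, i)))\<^sup>2)"
  \<comment> \<open>The ratios \<open>q k / p i\<close> and \<open>Q j / P j\<close> need positive
    denominators; the discarded indices carry no mass in \<open>m\<close> and
    \<open>P\<close>.\<close>
  define I where "I = {(i, k) \<in> ?I. 0 < p i}"
  define J where "J = {j \<in> {..<n}. 0 < P j}"
  have trP: "Re (mat_trace (spectral n E d * spectral n U p)) = (\<Sum>j<n. P j * d j)" for d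
    unfolding P_def using c by (simp add: Re_trace_spectral)
  have trQ: "Re (mat_trace (spectral n E d * spectral n V q)) = (\<Sum>j<n. Q j * d j)" for d
    unfolding Q_def using c by (simp add: Re_trace_spectral)
  have P0: "0 \<le> P j" if "j < n" for j
    unfolding P_def using psd_spectral[OF U p] c that by (intro psd_conj_index_nonneg[of n]) auto
  have Q0: "0 \<le> Q j" if "j < n" for j
    unfolding Q_def using psd_spectral[OF V q] c that by (intro psd_conj_index_nonneg[of n]) auto
  have P1: "(\<Sum>j<n. P j) = 1"
  proof -
    have "(\<Sum>j<n. P j * 1) = Re (mat_trace (spectral n U p))"
      unfolding trP[symmetric] spectral_one[OF E] using c by (simp add: left_mult_one_mat[of _ n n])
    then show ?thesis using tr by simp
  qed
  have C1: "mat_adjoint V * 1\<^sub>m n * U = C" unfolding C_def using c by (simp add: right_mult_one_mat[of _ n n])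
  have sq: "Re (cnj z * z) = (cmod z)\<^sup>2" for z
    by (metis Re_complex_of_real complex_norm_square mult.commute)
  have pos_part: "sum f I = sum f ?I" if "\<And>i k. i < n \<Longrightarrow> k < n \<Longrightarrow> p i = 0 \<Longrightarrow> f (i, k) = 0" for f :: "_ \<Rightarrow> real"
    by (rule sum.mono_neutral_left) (use that p in \<open>force simp: I_def\<close>)+
  have pos_part': "sum f J = sum f {..<n}" if "\<And>j. j < n \<Longrightarrow> P j = 0 \<Longrightarrow> f j = 0" for f :: "_ \<Rightarrow> real"
    by (rule sum.mono_neutral_left) (use that P0 in \<open>force simp: J_def\<close>)+
  have "I \<subseteq> ?I" by (auto simp: I_def)
  then have fin: "finite I" "finite J" by (auto simp: J_def intro: finite_subset)
  have "(\<Sum>ik\<in>?I. m ik) = Re (mat_trace (spectral n U p * (mat_adjoint (1\<^sub>m n) * (spectral n V (\<lambda>_. 1) * 1\<^sub>m n))))"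
    unfolding trace_spectral_mult_spectral[OF U V one_carrier_mat one_carrier_mat] C1 sq m_def by simp
  also have "\<dots> = 1" unfolding spectral_one[OF V] using c tr by (simp add: right_mult_one_mat[of _ n n])
  finally have m1: "(\<Sum>ik\<in>I. m ik) = 1" by (subst pos_part) (auto simp: m_def)
  have PJ1: "(\<Sum>j\<in>J. P j) = 1" using P1 by (subst pos_part') auto
  \<comment> \<open>The shift \<open>s\<close> keeps every argument of \<open>ln\<close> positive,
    even where \<open>q k = 0\<close>. It is sent to 0 after the comparison.\<close>
  have bound: "- ?R \<le> (\<Sum>j\<in>J. P j * ln (Q j / P j + s))" if s: "0 < s" for s
  proof -
    have "- ?R = (\<Sum>ik\<in>I. m ik * ln (q (snd ik) / p (fst ik)))"
    proof -
      have "- ?R = (\<Sum>ik\<in>?I. - (p (fst ik) * (ln (p (fst ik)) - ln (q (snd ik))) * (cmod (C $$ (snd ik, fst ik)))\<^sup>2))"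
        unfolding spectral_relative_entropy[OF U V] C_def by (simp add: sum_negf case_prod_unfold)
      also have "\<dots> = (\<Sum>ik\<in>I. - (p (fst ik) * (ln (p (fst ik)) - ln (q (snd ik))) * (cmod (C $$ (snd ik, fst ik)))\<^sup>2))"
        by (rule pos_part[symmetric]) simp
      also have "\<dots> = (\<Sum>ik\<in>I. m ik * ln (q (snd ik) / p (fst ik)))"
      proof (rule sum.cong[OF refl])
        fix ik assume "ik \<in> I"
        then obtain i k where ik: "ik = (i, k)" "i < n" "k < n" "0 < p i" by (auto simp: I_def)
        show "- (p (fst ik) * (ln (p (fst ik)) - ln (q (snd ik))) * (cmod (C $$ (snd ik, fst ik)))\<^sup>2)
            = m ik * ln (q (snd ik) / p (fst ik))"
        proof (cases "q k = 0")
          case True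
          then show ?thesis using supp[of i k] ik by (simp add: m_def C_def)
        next
          case False
          then have "0 < q k" using q[OF ik(3)] by simp
          then show ?thesis using ik by (simp add: m_def ln_div algebra_simps)
        qed
      qed
      finally show ?thesis .
    qed
    also have "\<dots> \<le> (\<Sum>ik\<in>I. m ik * ln (q (snd ik) / p (fst ik) + s))"
    proof (rule sum_mono)
      fix ik assume "ik \<in> I"
      then obtain i k where ik: "ik = (i, k)" "i < n" "k < n" "0 < p i" by (auto simp: I_def)
      show "m ik * ln (q (snd ik) / p (fst ik)) \<le> m ik * ln (q (snd ik) / p (fst ik) + s)"
      proof (cases "q k = 0")
        case True
        then show ?thesis using supp[of i k] ik by (simp add: m_def C_def)
      next
        case False
        then have "0 < q k / p i" using q[OF ik(3)] ik by simp
        then have "ln (q k / p i) \<le> ln (q k / p i + s)" using s by (subst ln_le_cancel_iff) auto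
        then show ?thesis using ik by (auto simp: m_def intro!: mult_left_mono)
      qed
    qed
    also have "\<dots> \<le> (\<Sum>j\<in>J. P j * ln (Q j / P j + s))"
    proof (rule sum_ln_le_of_resolvent)
      fix t :: real assume t: "0 \<le> t"
      define t' where "t' = t + s"
      have t': "0 < t'" using s t by (simp add: t'_def)
      \<comment> \<open>The resolvent of the modular operator is a maximum of concave quadratic
        expressions over test operators. Among those diagonal in \<open>E\<close> this
        \<open>x\<close> is optimal and reproduces the resolvent sum of the diagonals; the value 0
        where \<open>P j\<close> vanishes lets the sum run over all indices.\<close>
      define x where "x j = (if 0 < P j then P j / (Q j + t' * P j) else 0)" for j
      define X where "X = spectral n E x"
      have X: "X \<in> carrier_mat n n" and Xadj: "mat_adjoint X = X" and XX: "X * X = spectral n E (\<lambda>j. (x j)\<^sup>2)"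
        using c by (simp_all add: X_def adjoint_spectral spectral_mult[OF E] power2_eq_square)
      define H where "H = mat_adjoint V * X * U"
      note assoc = assoc_mult_mat[of _ n n _ n _ n]
      have comm: "mat_trace (A * B) = mat_trace (B * A)" if "A \<in> carrier_mat n n" "B \<in> carrier_mat n n" for A B
        using that by (rule trace_comm)
      have lin: "(\<Sum>(i, k)\<in>?I. p i * Re (cnj (C $$ (k, i)) * H $$ (k, i))) = (\<Sum>j<n. P j * x j)"
      proof -
        have "(\<Sum>(i, k)\<in>?I. p i * Re (cnj (C $$ (k, i)) * H $$ (k, i)))
            = Re (mat_trace (spectral n U p * (mat_adjoint (1\<^sub>m n) * (spectral n V (\<lambda>_. 1) * X))))"
          unfolding trace_spectral_mult_spectral[OF U V one_carrier_mat X] C1 H_def by simp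
        also have "\<dots> = Re (mat_trace (X * spectral n U p))"
          unfolding spectral_one[OF V] using c X comm[of X "spectral n U p"] by (simp add: left_mult_one_mat[of _ n n])
        finally show ?thesis unfolding X_def trP .
      qed
      have quad1: "(\<Sum>(i, k)\<in>?I. p i * (cmod (H $$ (k, i)))\<^sup>2) = (\<Sum>j<n. P j * (x j)\<^sup>2)"
      proof -
        have "(\<Sum>(i, k)\<in>?I. p i * (cmod (H $$ (k, i)))\<^sup>2)
            = Re (mat_trace (spectral n U p * (mat_adjoint X * (spectral n V (\<lambda>_. 1) * X))))"
          unfolding trace_spectral_mult_spectral[OF U V X X] H_def[symmetric] sq by simp
        also have "\<dots> = Re (mat_trace ((X * X) * spectral n U p))"
          unfolding spectral_one[OF V] Xadj using c X comm[of "X * X" "spectral n U p"]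
          by (simp add: left_mult_one_mat[of _ n n])
        finally show ?thesis unfolding XX trP .
      qed
      have quad2: "(\<Sum>(i, k)\<in>?I. q k * (cmod (H $$ (k, i)))\<^sup>2) = (\<Sum>j<n. Q j * (x j)\<^sup>2)"
      proof -
        have "(\<Sum>(i, k)\<in>?I. q k * (cmod (H $$ (k, i)))\<^sup>2)
            = Re (mat_trace (spectral n U (\<lambda>_. 1) * (mat_adjoint X * (spectral n V q * X))))"
          unfolding trace_spectral_mult_spectral[OF U V X X] H_def[symmetric] sq by simp
        also have "\<dots> = Re (mat_trace ((X * X) * spectral n V q))"
          unfolding spectral_one[OF U] Xadj using c X comm[of X "spectral n V q * X"] comm[of "X * X" "spectral n V q"]
          by (simp add: left_mult_one_mat[of _ n n] assoc)
        finally show ?thesis unfolding XX trQ .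
      qed
      have "(\<Sum>j\<in>J. P j / (Q j / P j + s + t)) = (\<Sum>j\<in>J. 2 * (P j * x j) - (Q j * (x j)\<^sup>2 + t' * (P j * (x j)\<^sup>2)))"
      proof (rule sum.cong[OF refl])
        fix j assume "j \<in> J"
        then have j: "j < n" "0 < P j" by (auto simp: J_def)
        then have D: "0 < Q j + t' * P j" using Q0[of j] t' by (simp add: add_nonneg_pos)
        have "Q j * (x j)\<^sup>2 + t' * (P j * (x j)\<^sup>2) = (Q j + t' * P j) * x j * x j"
          by (simp add: algebra_simps power2_eq_square)
        also have "(Q j + t' * P j) * x j = P j" using D j by (simp add: x_def)
        finally have "2 * (P j * x j) - (Q j * (x j)\<^sup>2 + t' * (P j * (x j)\<^sup>2)) = P j * x j" by simp
        moreover have "P j / (Q j / P j + s + t) = P j * x j"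
        proof -
          have "Q j / P j + s + t = (Q j + t' * P j) / P j" using j by (simp add: t'_def field_simps)
          then show ?thesis using j by (simp add: x_def)
        qed
        ultimately show "P j / (Q j / P j + s + t) = 2 * (P j * x j) - (Q j * (x j)\<^sup>2 + t' * (P j * (x j)\<^sup>2))"
          by simp
      qed
      also have "\<dots> = (\<Sum>j<n. 2 * (P j * x j) - (Q j * (x j)\<^sup>2 + t' * (P j * (x j)\<^sup>2)))"
        by (rule pos_part') (simp add: x_def)
      also have "\<dots> = (\<Sum>(i, k)\<in>?I. 2 * (p i * Re (cnj (C $$ (k, i)) * H $$ (k, i)))
          - (q k * (cmod (H $$ (k, i)))\<^sup>2 + t' * (p i * (cmod (H $$ (k, i)))\<^sup>2)))"
        using lin quad1 quad2
        by (simp add: case_prod_unfold sum_subtractf sum.distrib flip: sum_distrib_left)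
      also have "\<dots> \<le> (\<Sum>(i, k)\<in>?I. if 0 < p i then m (i, k) / (q k / p i + s + t) else 0)"
      proof (rule sum_mono, clarify)
        fix i k assume ik: "i < n" "k < n"
        let ?c = "C $$ (k, i)" and ?h = "H $$ (k, i)"
        show "2 * (p i * Re (cnj ?c * ?h)) - (q k * (cmod ?h)\<^sup>2 + t' * (p i * (cmod ?h)\<^sup>2))
          \<le> (if 0 < p i then m (i, k) / (q k / p i + s + t) else 0)"
        proof (cases "0 < p i")
          case True
          define D where "D = q k + t' * p i"
          have D: "0 < D" using q[OF ik(2)] t' True by (simp add: D_def add_nonneg_pos)
          \<comment> \<open>Completing the square in \<open>?h\<close> bounds the expression by its
            maximum, which is exactly the resolvent term of the pair (i, k).\<close>
          have "0 \<le> (cmod (p i * ?c - D * ?h))\<^sup>2" by simp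
          also have "\<dots> = (p i)\<^sup>2 * (cmod ?c)\<^sup>2 - 2 * D * (p i * Re (cnj ?c * ?h)) + D\<^sup>2 * (cmod ?h)\<^sup>2"
            unfolding cmod_power2 by (simp add: power2_eq_square algebra_simps)
          finally have "D * (2 * (p i * Re (cnj ?c * ?h)) - D * (cmod ?h)\<^sup>2) \<le> (p i)\<^sup>2 * (cmod ?c)\<^sup>2"
            by (simp add: algebra_simps power2_eq_square)
          then have "2 * (p i * Re (cnj ?c * ?h)) - D * (cmod ?h)\<^sup>2 \<le> (p i)\<^sup>2 * (cmod ?c)\<^sup>2 / D"
            using D by (simp add: pos_le_divide_eq mult.commute)
          also have "(p i)\<^sup>2 * (cmod ?c)\<^sup>2 / D = m (i, k) / (q k / p i + s + t)"
          proof -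
            have "q k / p i + s + t = D / p i" using True by (simp add: D_def t'_def field_simps)
            then show ?thesis by (simp add: m_def power2_eq_square)
          qed
          finally show ?thesis using True by (simp add: D_def algebra_simps)
        next
          case False
          then have "p i = 0" using p[OF ik(1)] by simp
          then show ?thesis using q[OF ik(2)] by simp
        qed
      qed
      also have "\<dots> = (\<Sum>ik\<in>I. if 0 < p (fst ik) then m ik / (q (snd ik) / p (fst ik) + s + t) else 0)"
        by (subst pos_part) (auto simp: case_prod_unfold intro!: sum.cong)
      also have "\<dots> = (\<Sum>ik\<in>I. m ik / (q (snd ik) / p (fst ik) + s + t))"
        by (intro sum.cong) (auto simp: I_def)
      finally show "(\<Sum>j\<in>J. P j / (Q j / P j + s + t)) \<le> (\<Sum>ik\<in>I. m ik / (q (snd ik) / p (fst ik) + s + t))" .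
    qed (use fin m1 PJ1 s q Q0 in \<open>auto simp: I_def J_def intro!: add_nonneg_pos\<close>)
    finally show ?thesis .
  qed
  have "?L \<le> ?R + s * (\<Sum>j<n. P j * y j)" if s: "0 < s" for s
  proof -
    have "(\<Sum>j\<in>J. P j * ln (Q j / P j + s)) \<le> (\<Sum>j\<in>J. y j * Q j + s * (P j * y j) - P j - P j * ln (y j))"
    proof (rule sum_mono)
      fix j assume "j \<in> J"
      then have j: "j < n" "0 < P j" by (auto simp: J_def)
      have pos: "0 < Q j / P j + s" using Q0[of j] j s by (simp add: add_nonneg_pos)
      \<comment> \<open>The scalar variational bound: it trades the logarithm of the ratio for a
        term linear in \<open>Q j\<close>, at the price of \<open>ln (y j)\<close>.\<close>
      have "ln (y j * (Q j / P j + s)) \<le> y j * (Q j / P j + s) - 1"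
        using pos y[OF j(1)] by (intro ln_le_minus_one) simp
      then have "ln (Q j / P j + s) \<le> y j * (Q j / P j + s) - 1 - ln (y j)"
        using pos y[OF j(1)] by (simp add: ln_mult_pos)
      then have "P j * ln (Q j / P j + s) \<le> P j * (y j * (Q j / P j + s) - 1 - ln (y j))"
        using j by (intro mult_left_mono) auto
      also have "\<dots> = y j * Q j + s * (P j * y j) - P j - P j * ln (y j)"
        using j by (simp add: field_simps)
      finally show "P j * ln (Q j / P j + s) \<le> y j * Q j + s * (P j * y j) - P j - P j * ln (y j)" .
    qed
    also have "\<dots> \<le> (\<Sum>j<n. y j * Q j + s * (P j * y j) - P j - P j * ln (y j))"
    proof (rule sum_mono2)
      fix j assume "j \<in> {..<n} - J"
      then have "P j = 0" "j < n" using P0[of j] by (auto simp: J_def)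
      then show "0 \<le> y j * Q j + s * (P j * y j) - P j - P j * ln (y j)"
        using Q0[of j] y[of j] by simp
    qed (auto simp: J_def)
    also have "\<dots> = s * (\<Sum>j<n. P j * y j) - ?L"
      unfolding trP trQ using P1
      by (simp add: sum.distrib sum_subtractf sum_distrib_left mult.commute)
    finally show ?thesis using bound[OF s] by simp
  qed
  then have *: "?L \<le> ?R + e" if "0 < e" for e
  proof -
    let ?y = "\<Sum>j<n. P j * y j"
    have y0: "0 \<le> ?y" using P0 y by (intro sum_nonneg mult_nonneg_nonneg) (auto simp: less_imp_le)
    have "e / (?y + 1) * ?y \<le> e" using that y0 by (simp add: field_simps)
    moreover have "?L \<le> ?R + e / (?y + 1) * ?y"
      using \<open>\<And>s. 0 < s \<Longrightarrow> ?L \<le> ?R + s * ?y\<close>[of "e / (?y + 1)"] that y0 by simp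
    ultimately show ?thesis by linarith
  qed
  show ?thesis by (rule field_le_epsilon) (rule *)
qed

section \<open>Relative entropies and measurements\<close>

text \<open>An eigenvector of the first matrix with nonzero eigenvalue is orthogonal to its kernel,
  hence lies in both supports; one of the second matrix with eigenvalue 0 lies in the kernel. The
  entry in question is their inner product.\<close>

lemma supp_spectral_subset_orthogonal:
  assumes U: "unitary n U" and V: "unitary n V" and sub: "supp (spectral n U p) \<subseteq> supp (spectral n V q)"
    and ik: "i < n" "k < n" and p: "p i \<noteq> 0" and q: "q k = 0"
  shows "(mat_adjoint V * U) $$ (k, i) = 0"
proof -
  note c = U[THEN unitary_carrier] V[THEN unitary_carrier]
  note dims [simp] = carrier_matD[OF c(1)] carrier_matD[OF c(2)]
  let ?A = "spectral n U p" and ?B = "spectral n V q"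
  have "col U i \<in> supp ?A"
  proof -
    have "col U i \<bullet>c w = 0" if w: "w \<in> mat_kernel ?A" for w
    proof -
      have wc: "w \<in> carrier_vec n" and Aw: "?A *\<^sub>v w = 0\<^sub>v n"
        using w by (auto simp: mat_kernel_def)
      have UA: "mat_adjoint U * ?A = mat_diag n (\<lambda>i. complex_of_real (p i)) * mat_adjoint U"
      proof -
        have "mat_adjoint U * ?A = (mat_adjoint U * U) * (mat_diag n (\<lambda>i. complex_of_real (p i)) * mat_adjoint U)"
          using c by (simp add: spectral_def assoc_mult_mat[of _ n n _ n _ n])
        then show ?thesis using c by (simp add: unitary_left[OF U] left_mult_one_mat[of _ n n])
      qed
      have "(mat_diag n (\<lambda>i. complex_of_real (p i)) * mat_adjoint U) *\<^sub>v w = mat_adjoint U *\<^sub>v (?A *\<^sub>v w)"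
        using wc c unfolding UA[symmetric] by (intro assoc_mult_mat_vec[of _ n n _ n]) auto
      also have "\<dots> = 0\<^sub>v n" unfolding Aw using c by (intro eq_vecI) auto
      finally have "row (mat_diag n (\<lambda>i. complex_of_real (p i)) * mat_adjoint U) i \<bullet> w = 0"
        using ik wc c by (metis index_mult_mat_vec index_zero_vec(1) index_mult_mat(2) mat_diag_dim carrier_matD(1))
      then have "(\<Sum>j<n. p i * cnj (U $$ (j, i)) * w $ j) = 0"
        using ik wc c by (simp add: mat_diag_mult_left[of _ n n] scalar_prod_def lessThan_atLeast0)
      then have "p i * (\<Sum>j<n. cnj (U $$ (j, i)) * w $ j) = 0"
        by (simp add: sum_distrib_left mult.assoc)
      then have "(\<Sum>j<n. cnj (U $$ (j, i)) * w $ j) = 0" using p by simp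
      then have "cnj (\<Sum>j<n. cnj (U $$ (j, i)) * w $ j) = 0" by simp
      then show ?thesis using ik wc by (simp add: cscalar_prod_sum[OF wc])
    qed
    then show ?thesis using c ik by (simp add: supp_def)
  qed
  with sub have sup: "col U i \<in> supp ?B" by auto
  have "?B *\<^sub>v col V k = 0\<^sub>v n"
  proof -
    have "?B * V = (V * mat_diag n (\<lambda>i. complex_of_real (q i))) * (mat_adjoint V * V)"
      using c by (simp add: spectral_def assoc_mult_mat[of _ n n _ n _ n])
    then have BV: "?B * V = V * mat_diag n (\<lambda>i. complex_of_real (q i))"
      using c by (simp add: unitary_left[OF V] right_mult_one_mat[of _ n n])
    have "?B *\<^sub>v col V k = col (?B * V) k" using ik by (simp add: col_mult2[of _ n n _ n] c)
    also have "\<dots> = 0\<^sub>v n"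
      unfolding BV mat_diag_mult_right[OF c(2)] using ik q by (intro eq_vecI) auto
    finally show ?thesis .
  qed
  then have "col V k \<in> mat_kernel ?B" using c ik by (simp add: mat_kernel_def)
  with sup have "col U i \<bullet>c col V k = 0" by (auto simp: supp_def)
  moreover have "col U i \<bullet>c col V k = (mat_adjoint V * U) $$ (k, i)"
    using c ik by (simp add: cscalar_prod_sum[of _ n] index_mult_mat_sum[of _ n n _ n] mult.commute del: index_mult_mat)
  ultimately show ?thesis by simp
qed

lemma mat_diag_spectral: "mat_diag n (\<lambda>i. complex_of_real (d i)) = spectral n (1\<^sub>m n) d"
  by (simp add: spectral_def left_mult_one_mat[of _ n n] right_mult_one_mat[of _ n n])

lemma supp_mat_diag_mono:
  assumes "\<And>i. i < n \<Longrightarrow> q i = 0 \<Longrightarrow> p i = 0"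
  shows "supp (mat_diag n p) \<subseteq> supp (mat_diag n q)"
proof -
  have ker: "mat_kernel (mat_diag n d) = {w \<in> carrier_vec n. \<forall>i<n. d i * w $ i = 0}" for d :: "nat \<Rightarrow> complex"
  proof -
    have "mat_diag n d *\<^sub>v w = 0\<^sub>v n \<longleftrightarrow> (\<forall>i<n. d i * w $ i = 0)" if w: "w \<in> carrier_vec n" for w
    proof -
      have "(mat_diag n d *\<^sub>v w) $ i = d i * w $ i" if "i < n" for i
      proof -
        have "(mat_diag n d *\<^sub>v w) $ i = (\<Sum>j<n. (if i = j then d j else 0) * w $ j)"
          using w that by (simp add: mat_diag_def scalar_prod_def lessThan_atLeast0)
        also have "\<dots> = (\<Sum>j<n. if i = j then d j * w $ j else 0)"
          by (intro sum.cong) auto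
        finally have "(mat_diag n d *\<^sub>v w) $ i = (\<Sum>j<n. if i = j then d j * w $ j else 0)" .
        then show ?thesis using that by simp
      qed
      then show ?thesis by (auto simp: vec_eq_iff mat_diag_def)
    qed
    then show ?thesis by (auto simp: mat_kernel_def mat_diag_def)
  qed
  have "mat_kernel (mat_diag n q) \<subseteq> mat_kernel (mat_diag n p)"
    unfolding ker using assms by auto
  then show ?thesis by (auto simp: supp_def mat_diag_def)
qed

text \<open>The weights \<open>p i / q i\<close> attain the classical variational formula, so a
  bound for all weights bounds the entropy itself. The same bound must first force absolute
  continuity, without which the entropy would be infinite.\<close>

lemma rel_entropy_mat_diag_le:
  assumes p: "\<And>i. i < n \<Longrightarrow> 0 \<le> p i" "(\<Sum>i<n. p i) = 1" and q: "\<And>i. i < n \<Longrightarrow> 0 \<le> q i"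
    and bound: "\<And>w. (\<And>i. i < n \<Longrightarrow> 0 < w i) \<Longrightarrow> (\<Sum>i<n. p i * ln (w i)) + 1 - (\<Sum>i<n. q i * w i) \<le> c"
  shows "rel_entropy (mat_diag n (\<lambda>i. complex_of_real (p i))) (mat_diag n (\<lambda>i. complex_of_real (q i))) \<le> ereal c"
proof -
  have ac: "p i = 0" if i: "i < n" "q i = 0" for i
  proof (rule ccontr)
    assume "p i \<noteq> 0"
    then have pi: "0 < p i" using p(1)[OF i(1)] by simp
    \<comment> \<open>A large weight where \<open>q i = 0\<close> adds nothing to the linear term;
      this exponent makes the left side of \<open>bound\<close> equal to c + 1.\<close>
    define s where "s = (c + (\<Sum>j<n. q j)) / p i"
    define w where "w j = (if j = i then exp s else 1)" for j
    have "(\<Sum>j<n. p j * ln (w j)) = (\<Sum>j<n. if j = i then p j * s else 0)"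
      by (intro sum.cong) (auto simp: w_def)
    also have "\<dots> = c + (\<Sum>j<n. q j)" using i pi by (simp add: s_def)
    finally have "(\<Sum>j<n. p j * ln (w j)) = c + (\<Sum>j<n. q j)" .
    moreover have "(\<Sum>j<n. q j * w j) = (\<Sum>j<n. q j)"
      using i by (intro sum.cong) (auto simp: w_def)
    moreover have "0 < w j" for j by (simp add: w_def)
    ultimately show False using bound[of w] by simp
  qed
  define D where "D = (\<Sum>i<n. p i * (ln (p i) - ln (q i)))"
  have D: "D \<le> c + e * (\<Sum>i<n. q i)" if e: "0 < e" for e
  proof -
    \<comment> \<open>The optimal weight 0 at \<open>p i = 0\<close> is not admissible; replacing it
      by \<open>e\<close> costs at most \<open>e\<close> times the total mass of
      \<open>q\<close>.\<close>
    define w where "w i = (if p i = 0 then e else p i / q i)" for i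
    have w: "0 < w i" if "i < n" for i
      using ac[OF that] p(1)[OF that] q[OF that] e by (auto simp: w_def less_le intro!: divide_pos_pos)
    have "(\<Sum>i<n. p i * ln (w i)) = D"
      unfolding D_def
    proof (intro sum.cong refl)
      fix i assume "i \<in> {..<n}"
      then show "p i * ln (w i) = p i * (ln (p i) - ln (q i))"
        using ac[of i] p(1)[of i] q[of i] by (cases "p i = 0") (auto simp: w_def ln_div)
    qed
    moreover have "(\<Sum>i<n. q i * w i) \<le> (\<Sum>i<n. p i + e * q i)"
    proof (rule sum_mono)
      fix i assume "i \<in> {..<n}"
      then show "q i * w i \<le> p i + e * q i" using ac[of i] q[of i] e by (auto simp: w_def)
    qed
    ultimately show ?thesis using bound[of w, OF w] p(2) by (simp add: sum.distrib sum_distrib_left)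
  qed
  have "D \<le> c"
  proof (rule field_le_epsilon)
    fix e :: real assume e: "0 < e"
    let ?q = "\<Sum>i<n. q i"
    have q0: "0 \<le> ?q" using q by (intro sum_nonneg) auto
    have "e / (?q + 1) * ?q \<le> e" using e q0 by (simp add: field_simps)
    with D[of "e / (?q + 1)"] e q0 show "D \<le> c + e" by simp
  qed
  moreover have "Re (mat_trace (mat_diag n (\<lambda>i. complex_of_real (p i)) *
      (mat_log (mat_diag n (\<lambda>i. complex_of_real (p i))) - mat_log (mat_diag n (\<lambda>i. complex_of_real (q i)))))) = D"
  proof -
    have "mat_diag n (\<lambda>i. complex_of_real (p i)) *
        (mat_log (mat_diag n (\<lambda>i. complex_of_real (p i))) - mat_log (mat_diag n (\<lambda>i. complex_of_real (q i))))
      = mat_diag n (\<lambda>i. complex_of_real (p i * (ln (p i) - ln (q i))))"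
    proof -
      have "mat_diag n (\<lambda>i. complex_of_real (ln (p i))) - mat_diag n (\<lambda>i. complex_of_real (ln (q i)))
          = mat_diag n (\<lambda>i. complex_of_real (ln (p i) - ln (q i)))"
        by (rule eq_matI) (auto simp: mat_diag_def)
      then show ?thesis
        unfolding mat_diag_spectral mat_log_spectral[OF unitary_one] unfolding mat_diag_spectral[symmetric] by simp
    qed
    then show ?thesis by (simp add: mat_trace_def mat_diag_def D_def)
  qed
  ultimately show ?thesis
    using supp_mat_diag_mono[of n "\<lambda>i. complex_of_real (q i)" "\<lambda>i. complex_of_real (p i)"] ac
    by (simp add: rel_entropy_def)
qed

section \<open>Outcome statistics of measurements and data processing\<close>

lemma trace_adjoint: "A \<in> carrier_mat n n \<Longrightarrow> mat_trace (mat_adjoint A) = cnj (mat_trace A)"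
  by (simp add: mat_trace_def)

lemma trace_psd_mult_real:
  assumes "psd n A" "psd n B"
  shows "mat_trace (A * B) = complex_of_real (Re (mat_trace (A * B)))"
proof -
  note c = assms[THEN psd_carrier]
  have "cnj (mat_trace (A * B)) = mat_trace (mat_adjoint (A * B))"
    using c by (simp add: trace_adjoint[of _ n])
  also have "\<dots> = mat_trace (B * A)"
    using assms[THEN psd_adjoint] c by (simp add: adjoint_mult[of _ n n _ n])
  also have "\<dots> = mat_trace (A * B)" using c by (intro trace_comm)
  finally show ?thesis by (simp add: complex_eq_iff)
qed

lemma povm_channel_real:
  assumes "\<And>x. x < k \<Longrightarrow> psd n (M x)" "psd n X"
  shows "povm_channel k M X = mat_diag k (\<lambda>x. complex_of_real (Re (mat_trace (M x * X))))"
  unfolding povm_channel_def mat_diag_def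
  by (intro cong_mat refl) (use assms trace_psd_mult_real in auto)

lemma povm_mat_sum: "povm n k M \<longleftrightarrow> (\<forall>x<k. psd n (M x)) \<and> mat_sum n {..<k} M = 1\<^sub>m n"
  by (simp add: povm_def mat_sum_def)

lemma povm_sum_trace:
  assumes "povm n k M" "X \<in> carrier_mat n n"
  shows "(\<Sum>x<k. mat_trace (M x * X)) = mat_trace X"
  using trace_mat_sum_mult[of "{..<k}" M n X] assms
  by (simp add: povm_mat_sum psd_carrier left_mult_one_mat[of _ n n])

text \<open>This replaces the supremum over channels, with its possibly infinite terms, by
  constraints affine in \<open>\<tau>\<close>, the form in which an extension can be searched
  for.\<close>

lemma measured_rel_entropy_leI:
  assumes \<rho>: "\<rho> \<in> density_mats n" and \<tau>: "psd n \<tau>"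
    and bound: "\<And>k M w. povm n k M \<Longrightarrow> (\<And>x. x < k \<Longrightarrow> 0 < w x) \<Longrightarrow>
      (\<Sum>x<k. Re (mat_trace (M x * \<rho>)) * ln (w x)) + 1 - (\<Sum>x<k. Re (mat_trace (M x * \<tau>)) * w x) \<le> c"
  shows "measured_rel_entropy \<rho> \<tau> \<le> ereal c"
  unfolding measured_rel_entropy_def
proof (rule SUP_least, clarify)
  have \<rho>p: "psd n \<rho>" and \<rho>t: "mat_trace \<rho> = 1" using \<rho> by (auto simp: density_mats_def)
  note \<rho>c = psd_carrier[OF \<rho>p]
  fix k M assume "povm (dim_row \<rho>) k M"
  then have M: "povm n k M" using \<rho>c by simp
  then have Mp: "psd n (M x)" if "x < k" for x using that by (simp add: povm_def)
  have ch: "povm_channel k M X = mat_diag k (\<lambda>x. complex_of_real (Re (mat_trace (M x * X))))"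
    if "psd n X" for X
    using Mp that by (rule povm_channel_real)
  show "rel_entropy (povm_channel k M \<rho>) (povm_channel k M \<tau>) \<le> ereal c"
    unfolding ch[OF \<rho>p] ch[OF \<tau>]
  proof (rule rel_entropy_mat_diag_le)
    show "(\<Sum>x<k. Re (mat_trace (M x * \<rho>))) = 1"
      using povm_sum_trace[OF M \<rho>c] \<rho>t by (simp flip: Re_sum)
  qed (use bound[OF M] in \<open>auto intro!: trace_psd_mult_nonneg[of n] Mp \<rho>p \<tau>\<close>)
qed

lemma povm_kron_id:
  assumes "povm a k M"
  shows "povm (a * b) k (\<lambda>x. kron_id a b (M x))"
proof -
  have "mat_sum (a * b) {..<k} (\<lambda>x. kron_id a b (M x)) = kron_id a b (mat_sum a {..<k} M)"
    by (rule eq_mat_multI[of _ a b]) (auto simp: mat_sum_def kron_id_index mult_index_less)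
  with assms show ?thesis by (simp add: povm_mat_sum psd_kron_id kron_id_one)
qed

text \<open>POVMs on A lift by \<open>kron_id\<close> to AB with unchanged outcome statistics, so
  the supremum on AB includes every channel on A.\<close>

lemma measured_rel_entropy_ptrace_le:
  assumes \<rho>: "psd (a * b) \<rho>" and \<tau>: "psd (a * b) \<tau>"
  shows "measured_rel_entropy (ptrace_B a b \<rho>) (ptrace_B a b \<tau>) \<le> measured_rel_entropy \<rho> \<tau>"
  unfolding measured_rel_entropy_def
proof (rule SUP_least, clarify)
  fix k M assume "povm (dim_row (ptrace_B a b \<rho>)) k M"
  then have M: "povm a k M" by (simp add: ptrace_B_def)
  have ch: "povm_channel k M (ptrace_B a b X) = povm_channel k (\<lambda>x. kron_id a b (M x)) X"
    if "psd (a * b) X" for X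
    unfolding povm_channel_def mat_diag_def using M psd_carrier[OF that]
    by (intro cong_mat refl) (auto simp: povm_def trace_kron_id_mult psd_carrier)
  have "(k, \<lambda>x. kron_id a b (M x)) \<in> {(k, M). povm (dim_row \<rho>) k M}"
    using povm_kron_id[OF M] psd_carrier[OF \<rho>] by simp
  from SUP_upper[OF this, of "\<lambda>(k, M). rel_entropy (povm_channel k M \<rho>) (povm_channel k M \<tau>)"]
  show "rel_entropy (povm_channel k M (ptrace_B a b \<rho>)) (povm_channel k M (ptrace_B a b \<tau>))
      \<le> (SUP (k, M)\<in>{(k, M). povm (dim_row \<rho>) k M}. rel_entropy (povm_channel k M \<rho>) (povm_channel k M \<tau>))"
    unfolding ch[OF \<rho>] ch[OF \<tau>] by simp
qed

section \<open>Compactness and duality\<close>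

lemma trace_mult_mat_continuous:
  assumes "A \<in> carrier_mat n n"
  shows "continuous_on UNIV (\<lambda>X :: nat \<times> nat \<Rightarrow> complex. mat_trace (A * mat n n X))"
proof -
  have "mat_trace (A * mat n n X) = (\<Sum>i<n. \<Sum>k<n. A $$ (i, k) * X (k, i))" for X :: "nat \<times> nat \<Rightarrow> complex"
    using assms by (subst trace_mult[of _ n n]) auto
  then show ?thesis by (simp add: continuous_intros)
qed

lemma ptrace_mat_continuous:
  assumes "i < a" "j < a"
  shows "continuous_on UNIV (\<lambda>X :: nat \<times> nat \<Rightarrow> complex. ptrace_B a b (mat (a * b) (a * b) X) $$ (i, j))"
  using assms by (simp add: ptrace_B_def mult_index_less continuous_intros)

text \<open>Testing positivity on a vector supported on i and j, with a suitable phase, gives 2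
  |X_ij| \<le> X_ii + X_jj. A trace bound therefore bounds all entries, which is needed for
  compactness.\<close>

lemma psd_entry_le_trace:
  assumes X: "psd n X" and ij: "i < n" "j < n"
  shows "cmod (X $$ (i, j)) \<le> Re (mat_trace X)"
proof -
  note Xc = psd_carrier[OF X]
  have h: "X $$ (j, i) = cnj (X $$ (i, j))"
    using adjoint_index[of j X i] psd_adjoint[OF X] Xc ij by simp
  have diag: "0 \<le> Re (X $$ (k, k))" if "k < n" for k
    using psd_conj_index_nonneg[OF X one_carrier_mat that] Xc
    by (simp add: left_mult_one_mat[of _ n n] right_mult_one_mat[of _ n n])
  have tr: "Re (mat_trace X) = (\<Sum>k<n. Re (X $$ (k, k)))" using Xc by (simp add: mat_trace_def)
  show ?thesis
  proof (cases "i = j")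
    case True
    have "Im (X $$ (i, i)) = 0" using h True by (simp add: complex_eq_iff)
    then have "cmod (X $$ (i, j)) = Re (X $$ (i, i))"
      using True diag[OF ij(1)] by (simp add: cmod_eq_Re)
    also have "\<dots> \<le> (\<Sum>k<n. Re (X $$ (k, k)))" using ij diag by (intro member_le_sum) auto
    finally show ?thesis by (simp add: tr)
  next
    case False
    define z where "z = X $$ (i, j)"
    \<comment> \<open>This phase turns the two cross terms into minus twice the modulus of
      \<open>z\<close>; \<open>sgn 0 = 0\<close> covers a vanishing entry.\<close>
    define u where "u = - sgn z"
    define v where "v = vec n (\<lambda>k. if k = i then u else if k = j then 1 else 0)"
    have v: "v \<in> carrier_vec n" by (simp add: v_def)
    have two: "(\<Sum>k<n. f k * (if k = i then c else if k = j then d else 0)) = f i * c + f j * d"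
      for f :: "nat \<Rightarrow> complex" and c d
    proof -
      have "(\<Sum>k<n. f k * (if k = i then c else if k = j then d else 0))
          = (\<Sum>k<n. (if k = i then f k * c else 0) + (if k = j then f k * d else 0))"
        using False by (intro sum.cong) auto
      then show ?thesis using ij by (simp add: sum.distrib)
    qed
    have Xv: "(X *\<^sub>v v) $ k = X $$ (k, i) * u + X $$ (k, j)" if "k < n" for k
    proof -
      have "(X *\<^sub>v v) $ k = (\<Sum>l<n. X $$ (k, l) * (if l = i then u else if l = j then 1 else 0))"
        using Xc that by (simp add: v_def scalar_prod_def lessThan_atLeast0)
      then show ?thesis unfolding two by simp
    qed
    have "(X *\<^sub>v v) \<bullet>c v = (\<Sum>k<n. (X *\<^sub>v v) $ k * (if k = i then cnj u else if k = j then 1 else 0))"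
      unfolding cscalar_prod_sum[OF v] by (intro sum.cong) (auto simp: v_def)
    also have "\<dots> = (X $$ (i, i) * u + z) * cnj u + (cnj z * u + X $$ (j, j))"
      unfolding two using ij h by (simp add: Xv z_def)
    finally have qf: "(X *\<^sub>v v) \<bullet>c v = (X $$ (i, i) * u + z) * cnj u + (cnj z * u + X $$ (j, j))" .
    have "0 \<le> Re ((X *\<^sub>v v) \<bullet>c v)" using X v by (simp add: psd_def)
    then have "0 \<le> Re ((X $$ (i, i) * u + z) * cnj u + (cnj z * u + X $$ (j, j)))" unfolding qf .
    also have "\<dots> = Re (X $$ (i, i)) * (cmod u)\<^sup>2 + 2 * Re (cnj z * u) + Re (X $$ (j, j))"
      unfolding cmod_power2 by (simp add: algebra_simps power2_eq_square)
    also have "Re (cnj z * u) = - cmod z"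
    proof -
      have "cnj z * sgn z = complex_of_real (cmod z)"
        by (cases "z = 0") (simp_all add: sgn_eq complex_norm_square[symmetric] power2_eq_square mult.commute)
      then show ?thesis by (simp add: u_def)
    qed
    also have "Re (X $$ (i, i)) * (cmod u)\<^sup>2 \<le> Re (X $$ (i, i))"
      using diag[OF ij(1)] by (simp add: u_def norm_sgn)
    finally have "2 * cmod z \<le> Re (X $$ (i, i)) + Re (X $$ (j, j))" by simp
    also have "\<dots> \<le> (\<Sum>k\<in>{i, j}. Re (X $$ (k, k)))" using False by simp
    also have "\<dots> \<le> (\<Sum>k<n. Re (X $$ (k, k)))" using ij diag by (intro sum_mono2) auto
    finally have "2 * cmod z \<le> Re (mat_trace X)" by (simp add: tr)
    then show ?thesis using norm_ge_zero[of z] unfolding z_def by linarith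
  qed
qed

lemma compact_complex_box: "compact {z. \<bar>Re z\<bar> \<le> R \<and> \<bar>Im z\<bar> \<le> R}"
proof -
  have "compact ((\<lambda>(x, y). complex_of_real x + \<i> * complex_of_real y) ` ({- R..R} \<times> {- R..R}))"
    unfolding case_prod_unfold
    by (intro compact_continuous_image continuous_intros compact_Times compact_Icc)
  moreover have "{z. \<bar>Re z\<bar> \<le> R \<and> \<bar>Im z\<bar> \<le> R}
      = (\<lambda>(x, y). complex_of_real x + \<i> * complex_of_real y) ` ({- R..R} \<times> {- R..R})"
  proof (intro equalityI subsetI)
    fix z assume "z \<in> {z. \<bar>Re z\<bar> \<le> R \<and> \<bar>Im z\<bar> \<le> R}"
    then show "z \<in> (\<lambda>(x, y). complex_of_real x + \<i> * complex_of_real y) ` ({- R..R} \<times> {- R..R})"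
      using complex_eq[of z] by (intro image_eqI[of _ _ "(Re z, Im z)"]) auto
  qed auto
  ultimately show ?thesis by simp
qed

text \<open>Matrices are represented by their entries, extended by \<open>0\<close>, so that the product topology applies.\<close>

lemma compact_psd_trace_le:
  "compact {X :: nat \<times> nat \<Rightarrow> complex. (\<forall>ij. ij \<notin> {..<n} \<times> {..<n} \<longrightarrow> X ij = 0) \<and>
     psd n (mat n n X) \<and> Re (mat_trace (mat n n X)) \<le> R}" (is "compact ?K")
proof -
  \<comment> \<open>Tychonoff applies to this product of compact boxes; the factors outside the
    matrix block are singletons, since free coordinates there would destroy compactness.\<close>
  define B where "B = Pi\<^sub>E UNIV (\<lambda>ij. if ij \<in> {..<n} \<times> {..<n} then {z. \<bar>Re z\<bar> \<le> R \<and> \<bar>Im z\<bar> \<le> R} else {0})"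
  have "compactin (product_topology (\<lambda>_. euclidean) UNIV) B"
    unfolding B_def compactin_PiE by (simp add: compact_complex_box)
  then have B: "compact B" by (simp add: euclidean_product_topology)
  define H where "H = {X :: nat \<times> nat \<Rightarrow> complex. \<forall>i<n. \<forall>j<n. cnj (X (j, i)) = X (i, j)}"
  define Q where "Q = (\<Inter>v\<in>carrier_vec n. {X. 0 \<le> Re (mat_trace (rank_one n v * mat n n X))})"
  define T where "T = {X. Re (mat_trace (mat n n X)) \<le> R}"
  have psd: "psd n (mat n n X) \<longleftrightarrow> X \<in> H \<inter> Q" for X :: "nat \<times> nat \<Rightarrow> complex"
  proof -
    have "mat_adjoint (mat n n X) = mat n n X \<longleftrightarrow> X \<in> H"
    proof
      assume eq: "mat_adjoint (mat n n X) = mat n n X"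
      show "X \<in> H" unfolding H_def
      proof (clarify)
        fix i j assume "i < n" "j < n"
        then show "cnj (X (j, i)) = X (i, j)" using adjoint_index[of i "mat n n X" j] unfolding eq by simp
      qed
    qed (rule eq_matI, auto simp: H_def)
    moreover have "mat_trace (mat n n X * rank_one n v) = mat_trace (rank_one n v * mat n n X)" for v
      by (rule trace_comm[of _ n n]) auto
    ultimately show ?thesis by (auto simp: psd_iff_trace Q_def)
  qed
  have "H = (\<Inter>i\<in>{..<n}. \<Inter>j\<in>{..<n}. {X. cnj (X (j, i)) = X (i, j)})" by (auto simp: H_def)
  then have "closed H"
    by (auto intro!: closed_INT closed_Collect_eq continuous_intros)
  moreover have "closed Q" unfolding Q_def
    by (intro closed_INT ballI closed_Collect_le continuous_on_Re trace_mult_mat_continuous continuous_on_const) simp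
  moreover have "closed T"
  proof -
    have "T = {X. Re (mat_trace (1\<^sub>m n * mat n n X)) \<le> R}"
      by (simp add: T_def left_mult_one_mat[of _ n n])
    then show ?thesis
      by (simp only:) (intro closed_Collect_le continuous_on_Re trace_mult_mat_continuous continuous_on_const, simp)
  qed
  ultimately have "compact (B \<inter> (H \<inter> Q \<inter> T))" by (intro compact_Int_closed B closed_Int)
  moreover have "?K = B \<inter> (H \<inter> Q \<inter> T)"
  proof
    show "?K \<subseteq> B \<inter> (H \<inter> Q \<inter> T)"
    proof
      fix X assume X: "X \<in> ?K"
      then have "cmod (X (i, j)) \<le> R" if "i < n" "j < n" for i j
        using psd_entry_le_trace[of n "mat n n X" i j] that by auto
      then have "\<bar>Re (X (i, j))\<bar> \<le> R" "\<bar>Im (X (i, j))\<bar> \<le> R" if "i < n" "j < n" for i j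
        using that abs_Re_le_cmod[of "X (i, j)"] abs_Im_le_cmod[of "X (i, j)"] order_trans by blast+
      with X show "X \<in> B \<inter> (H \<inter> Q \<inter> T)"
        using psd[of X] by (auto simp: B_def T_def PiE_def Pi_def)
    qed
    show "B \<inter> (H \<inter> Q \<inter> T) \<subseteq> ?K"
    proof
      fix X assume X: "X \<in> B \<inter> (H \<inter> Q \<inter> T)"
      have "X ij = 0" if "ij \<notin> {..<n} \<times> {..<n}" for ij
      proof -
        have "X ij \<in> (if ij \<in> {..<n} \<times> {..<n} then {z. \<bar>Re z\<bar> \<le> R \<and> \<bar>Im z\<bar> \<le> R} else {0})"
          using X unfolding B_def by (intro PiE_mem[of X UNIV]) auto
        then show ?thesis using that by auto
      qed
      with X show "X \<in> ?K" using psd[of X] by (auto simp: T_def)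
    qed
  qed
  ultimately show ?thesis by simp
qed

definition entries :: "nat \<Rightarrow> complex mat \<Rightarrow> nat \<times> nat \<Rightarrow> complex" where
  "entries n X ij = (if ij \<in> {..<n} \<times> {..<n} then X $$ ij else 0)"

lemma mat_entries [simp]: "X \<in> carrier_mat n n \<Longrightarrow> mat n n (entries n X) = X"
  by (rule eq_matI) (auto simp: entries_def)

lemma entries_outside: "ij \<notin> {..<n} \<times> {..<n} \<Longrightarrow> entries n X ij = 0"
  by (auto simp: entries_def)

section \<open>Strong duality for extensions of a given marginal\<close>

lemma ptrace_add_smult:
  assumes "X \<in> carrier_mat (a * b) (a * b)" "Y \<in> carrier_mat (a * b) (a * b)"
  shows "ptrace_B a b (X + c \<cdot>\<^sub>m Y) = ptrace_B a b X + c \<cdot>\<^sub>m ptrace_B a b Y"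
  by (rule eq_matI) (use assms in \<open>auto simp: ptrace_B_def mult_index_less sum.distrib sum_distrib_left\<close>)

lemma psd_zero: "psd n (0\<^sub>m n n)"
proof -
  have "complex_of_real 0 \<cdot>\<^sub>m 1\<^sub>m n = 0\<^sub>m n n" by (rule eq_matI) auto
  then show ?thesis using psd_smult[OF psd_one, of 0 n] by simp
qed

lemma adjoint_mat_sum:
  assumes "\<And>j. j \<in> J \<Longrightarrow> N j \<in> carrier_mat n n" "\<And>j. j \<in> J \<Longrightarrow> mat_adjoint (N j) = N j"
  shows "mat_adjoint (mat_sum n J N) = mat_sum n J N"
proof (rule eq_matI)
  fix i j assume "i < dim_row (mat_sum n J N)" "j < dim_col (mat_sum n J N)"
  then have ij: "i < n" "j < n" by (auto simp: mat_sum_def)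
  have "cnj (N l $$ (j, i)) = N l $$ (i, j)" if "l \<in> J" for l
    using adjoint_index[of i "N l" j] assms[OF that] ij by simp
  then show "mat_adjoint (mat_sum n J N) $$ (i, j) = mat_sum n J N $$ (i, j)"
    using ij by (simp add: mat_sum_def)
qed (auto simp: mat_sum_def)

lemma trace_mult_hermitian:
  assumes Z: "Z \<in> carrier_mat n n" "mat_adjoint Z = Z" and W: "W \<in> carrier_mat n n"
  shows "Re (mat_trace (Z * W)) = (\<Sum>i<n. \<Sum>j<n. Re (cnj (Z $$ (i, j)) * W $$ (i, j)))"
proof -
  have h: "cnj (Z $$ (i, j)) = Z $$ (j, i)" if "i < n" "j < n" for i j
    using adjoint_index[of j Z i] Z that by simp
  have "Re (mat_trace (Z * W)) = (\<Sum>j<n. \<Sum>i<n. Re (Z $$ (j, i) * W $$ (i, j)))"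
    using Z W by (subst trace_mult[of _ n n]) auto
  also have "\<dots> = (\<Sum>i<n. \<Sum>j<n. Re (Z $$ (j, i) * W $$ (i, j)))" by (rule sum.swap)
  finally show ?thesis by (simp add: h del: complex_cnj_mult times_complex.sel)
qed

text \<open>After division by t the quadratic term fades for small t. Steps stop at t = 1 because
  moving from a positive matrix towards 0 stays in the cone only that far.\<close>

lemma nonneg_of_quadratic:
  fixes l q :: real
  assumes "\<And>t. 0 < t \<Longrightarrow> t \<le> 1 \<Longrightarrow> 0 \<le> 2 * t * l + t\<^sup>2 * q"
  shows "0 \<le> l"
proof (rule ccontr)
  assume "\<not> 0 \<le> l"
  then have l: "l < 0" by simp
  define t where "t = min 1 (- l / (\<bar>q\<bar> + 1))"
  have t: "0 < t" "t \<le> 1" using l by (auto simp: t_def divide_neg_pos)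
  have "t * \<bar>q\<bar> \<le> - l / (\<bar>q\<bar> + 1) * \<bar>q\<bar>" by (intro mult_right_mono) (auto simp: t_def)
  also have "\<dots> \<le> - l" using l by (simp add: field_simps)
  finally have "t * \<bar>q\<bar> \<le> - l" .
  moreover have "t * q \<le> t * \<bar>q\<bar>" using t by (intro mult_left_mono) auto
  moreover have "0 \<le> 2 * l + t * q"
  proof -
    have "0 \<le> t * (2 * l + t * q)"
      using assms[OF t] by (simp add: algebra_simps power2_eq_square)
    then show ?thesis using t(1) by (simp add: zero_le_mult_iff)
  qed
  ultimately show False using l by simp
qed

text \<open>The squared positive part has derivative \<open>2 * max 0 c\<close> and a second-order
  remainder of at most x^2. This explicit bound serves as its derivative in the first-order
  condition.\<close>

lemma pos_part_square_le: "(max 0 (c + x))\<^sup>2 \<le> (max 0 c)\<^sup>2 + 2 * max 0 c * x + x\<^sup>2" for c x :: real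
proof -
  have "(max 0 c)\<^sup>2 + 2 * max 0 c * x + x\<^sup>2 = (max 0 c + x)\<^sup>2" by (simp add: power2_sum)
  moreover have "(max 0 (c + x))\<^sup>2 \<le> (max 0 c + x)\<^sup>2"
  proof (cases "c + x \<le> 0")
    case False
    then show ?thesis by (intro power_mono) auto
  qed simp
  ultimately show ?thesis by simp
qed

text \<open>
  Duality for finitely many linear constraints on an extension of \<open>\<sigma>\<close>: the squared violation is minimised
  over all positive matrices, and the residuals at a minimiser form a dual certificate.
\<close>

lemma exists_extension_finite:
  fixes b :: "'i \<Rightarrow> real"
  assumes \<sigma>: "psd a \<sigma>" and I: "finite I" and \<omega>: "\<And>i. i \<in> I \<Longrightarrow> \<omega> i \<in> carrier_mat (a * d) (a * d)"
    and \<omega>h: "\<And>i. i \<in> I \<Longrightarrow> mat_adjoint (\<omega> i) = \<omega> i"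
    and dual: "\<And>Z l. Z \<in> carrier_mat a a \<Longrightarrow> mat_adjoint Z = Z \<Longrightarrow> (\<And>i. i \<in> I \<Longrightarrow> 0 \<le> l i) \<Longrightarrow>
      psd (a * d) (kron_id a d Z - mat_sum (a * d) I (\<lambda>i. complex_of_real (l i) \<cdot>\<^sub>m \<omega> i)) \<Longrightarrow>
      (\<Sum>i\<in>I. l i * b i) \<le> Re (mat_trace (Z * \<sigma>))"
  shows "\<exists>X. psd (a * d) X \<and> ptrace_B a d X = \<sigma> \<and> (\<forall>i\<in>I. b i \<le> Re (mat_trace (\<omega> i * X)))"
proof -
  define n where "n = a * d"
  note \<omega> = \<omega>[folded n_def] and dual = dual[folded n_def]
  note \<sigma>c = psd_carrier[OF \<sigma>]
  define Dev where "Dev X = (\<Sum>i<a. \<Sum>j<a. (cmod (ptrace_B a d X $$ (i, j) - \<sigma> $$ (i, j)))\<^sup>2)" for X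
  define \<Phi> where "\<Phi> X = Dev X + (\<Sum>i\<in>I. (max 0 (b i - Re (mat_trace (\<omega> i * X))))\<^sup>2)" for X
  \<comment> \<open>Beyond trace \<open>R\<close> some diagonal entry of the partial trace exceeds
    that of \<sigma> by more than \<open>\<Phi> (0\<^sub>m n n) + 1\<close>, so \<Phi> is no smaller
    than at the zero matrix. Minimising up to trace \<open>R\<close> hence minimises over the whole
    cone. The extra 1 puts that difference above 1, where it is below its own square.\<close>
  define R where "R = Re (mat_trace \<sigma>) + a * (\<Phi> (0\<^sub>m n n) + 1)"
  have \<Phi>0: "0 \<le> \<Phi> X" "Dev X \<le> \<Phi> X" for X
    by (auto simp: \<Phi>_def Dev_def intro!: add_nonneg_nonneg sum_nonneg)
  have R0: "0 \<le> R"
    using trace_psd_mult_nonneg[OF psd_one \<sigma>] \<sigma>c \<Phi>0(1)[of "0\<^sub>m n n"] by (simp add: R_def left_mult_one_mat[of _ a a])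
  define K where "K = {X :: nat \<times> nat \<Rightarrow> complex. (\<forall>ij. ij \<notin> {..<n} \<times> {..<n} \<longrightarrow> X ij = 0) \<and>
     psd n (mat n n X) \<and> Re (mat_trace (mat n n X)) \<le> R}"
  have "compact K" unfolding K_def by (rule compact_psd_trace_le)
  moreover have inK: "entries n X \<in> K" if "psd n X" "Re (mat_trace X) \<le> R" for X
    using that psd_carrier[OF that(1)] by (auto simp: K_def entries_outside)
  moreover have "Re (mat_trace (0\<^sub>m n n)) \<le> R" using R0 by (simp add: mat_trace_def)
  ultimately have "K \<noteq> {}" using psd_zero[of n] by blast
  moreover have "continuous_on K (\<lambda>X. \<Phi> (mat n n X))"
    unfolding \<Phi>_def Dev_def n_def
    by (rule continuous_on_subset[OF _ subset_UNIV])
       (intro continuous_intros continuous_on_Re ptrace_mat_continuous trace_mult_mat_continuous,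
        use \<omega> in \<open>auto simp: n_def\<close>)
  ultimately obtain x where x: "x \<in> K" "\<And>X. X \<in> K \<Longrightarrow> \<Phi> (mat n n x) \<le> \<Phi> (mat n n X)"
    using continuous_attains_inf[OF \<open>compact K\<close>] by meson
  define X where "X = mat n n x"
  have X: "psd n X" using x(1) by (simp add: K_def X_def)
  note Xc = psd_carrier[OF X]
  have min: "\<Phi> X \<le> \<Phi> Y" if Y: "psd n Y" for Y
  proof (cases "Re (mat_trace Y) \<le> R")
    case True
    then show ?thesis using x(2)[OF inK[OF Y True]] psd_carrier[OF Y] by (simp add: X_def)
  next
    case False
    note Yc = psd_carrier[OF Y]
    define e where "e i = Re (ptrace_B a d Y $$ (i, i)) - Re (\<sigma> $$ (i, i))" for i
    have "\<exists>i<a. \<Phi> (0\<^sub>m n n) + 1 < e i"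
    proof (rule ccontr)
      assume "\<not> ?thesis"
      then have "(\<Sum>i<a. e i) \<le> (\<Sum>i<a. \<Phi> (0\<^sub>m n n) + 1)" by (intro sum_mono) auto
      moreover have "(\<Sum>i<a. e i) = Re (mat_trace Y) - Re (mat_trace \<sigma>)"
        using trace_ptrace[of Y a d] Yc \<sigma>c
        by (simp add: e_def mat_trace_def n_def sum_subtractf ptrace_B_def flip: Re_sum)
      ultimately show False using False by (simp add: R_def)
    qed
    then obtain i where i: "i < a" "\<Phi> (0\<^sub>m n n) + 1 < e i" by auto
    have "\<Phi> (0\<^sub>m n n) \<le> (e i)\<^sup>2"
      using i \<Phi>0(1)[of "0\<^sub>m n n"] self_le_power[of "e i" 2] by simp
    also have "\<dots> \<le> (cmod (ptrace_B a d Y $$ (i, i) - \<sigma> $$ (i, i)))\<^sup>2"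
      by (simp add: cmod_power2 e_def)
    also have "\<dots> \<le> (\<Sum>j<a. (cmod (ptrace_B a d Y $$ (i, j) - \<sigma> $$ (i, j)))\<^sup>2)"
      using i(1) by (intro member_le_sum) auto
    also have "\<dots> \<le> Dev Y" unfolding Dev_def
      using i(1) by (intro member_le_sum[of i _ "\<lambda>i. \<Sum>j<a. (cmod (ptrace_B a d Y $$ (i, j) - \<sigma> $$ (i, j)))\<^sup>2"]) (auto intro: sum_nonneg)
    also have "\<dots> \<le> \<Phi> Y" by (rule \<Phi>0)
    finally have "\<Phi> (0\<^sub>m n n) \<le> \<Phi> Y" .
    moreover have "\<Phi> X \<le> \<Phi> (0\<^sub>m n n)"
      using x(2)[OF inK[OF psd_zero]] R0 by (simp add: X_def mat_trace_def)
    ultimately show ?thesis by simp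
  qed
  \<comment> \<open>The residuals \<open>Z\<close> and \<open>l\<close> at the minimiser are the
    dual variables.\<close>
  define Z where "Z = ptrace_B a d X - \<sigma>"
  define l where "l i = max 0 (b i - Re (mat_trace (\<omega> i * X)))" for i
  have Zc: "Z \<in> carrier_mat a a" using \<sigma>c by (simp add: Z_def minus_carrier_mat)
  have pX: "psd a (ptrace_B a d X)" using X unfolding n_def by (rule psd_ptrace)
  have Zh: "mat_adjoint Z = Z"
  proof -
    have "mat_adjoint Z = mat_adjoint (ptrace_B a d X) - mat_adjoint \<sigma>"
      using \<sigma>c by (intro eq_matI) (auto simp: Z_def ptrace_B_def)
    then show ?thesis using psd_adjoint[OF pX] psd_adjoint[OF \<sigma>] by (simp add: Z_def)
  qed
  have Zi: "Z $$ (i, j) = ptrace_B a d X $$ (i, j) - \<sigma> $$ (i, j)" if "i < a" "j < a" for i j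
    using that \<sigma>c by (simp add: Z_def)
  \<comment> \<open>\<open>2 * L W\<close> is the derivative of \<Phi> at \<open>X\<close> in
    direction \<open>W\<close>.\<close>
  define L where "L W = Re (mat_trace (Z * ptrace_B a d W)) - (\<Sum>i\<in>I. l i * Re (mat_trace (\<omega> i * W)))" for W
  have first_order: "0 \<le> L W" if W: "W \<in> carrier_mat n n"
    and feas: "\<And>t. 0 < t \<Longrightarrow> t \<le> 1 \<Longrightarrow> psd n (X + complex_of_real t \<cdot>\<^sub>m W)" for W
  proof (rule nonneg_of_quadratic)
    fix t :: real assume t: "0 < t" "t \<le> 1"
    define q where "q = (\<Sum>i<a. \<Sum>j<a. (cmod (ptrace_B a d W $$ (i, j)))\<^sup>2) + (\<Sum>i\<in>I. (Re (mat_trace (\<omega> i * W)))\<^sup>2)"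
    let ?Y = "X + complex_of_real t \<cdot>\<^sub>m W"
    have "Dev ?Y = (\<Sum>i<a. \<Sum>j<a. (cmod (Z $$ (i, j)))\<^sup>2
        + (2 * t * Re (cnj (Z $$ (i, j)) * ptrace_B a d W $$ (i, j)) + t\<^sup>2 * (cmod (ptrace_B a d W $$ (i, j)))\<^sup>2))"
      unfolding Dev_def
    proof (intro sum.cong refl)
      fix i j assume "i \<in> {..<a}" "j \<in> {..<a}"
      then have ij: "i < a" "j < a" by auto
      have "ptrace_B a d ?Y $$ (i, j) - \<sigma> $$ (i, j) = Z $$ (i, j) + complex_of_real t * ptrace_B a d W $$ (i, j)"
        using ptrace_add_smult[of X a d W "complex_of_real t"] Xc W ij Zi[OF ij]
        by (simp add: n_def carrier_matD[OF ptrace_carrier])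
      then show "(cmod (ptrace_B a d ?Y $$ (i, j) - \<sigma> $$ (i, j)))\<^sup>2 = (cmod (Z $$ (i, j)))\<^sup>2
        + (2 * t * Re (cnj (Z $$ (i, j)) * ptrace_B a d W $$ (i, j)) + t\<^sup>2 * (cmod (ptrace_B a d W $$ (i, j)))\<^sup>2)"
        unfolding cmod_power2 by (simp add: power2_eq_square algebra_simps)
    qed
    also have "\<dots> = Dev X + 2 * t * Re (mat_trace (Z * ptrace_B a d W))
        + t\<^sup>2 * (\<Sum>i<a. \<Sum>j<a. (cmod (ptrace_B a d W $$ (i, j)))\<^sup>2)"
      unfolding trace_mult_hermitian[OF Zc Zh ptrace_carrier] Dev_def
      by (simp add: sum.distrib Zi flip: sum_distrib_left)
    finally have devY: "Dev ?Y = Dev X + 2 * t * Re (mat_trace (Z * ptrace_B a d W))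
        + t\<^sup>2 * (\<Sum>i<a. \<Sum>j<a. (cmod (ptrace_B a d W $$ (i, j)))\<^sup>2)" .
    have "(\<Sum>i\<in>I. (max 0 (b i - Re (mat_trace (\<omega> i * ?Y))))\<^sup>2)
        \<le> (\<Sum>i\<in>I. (l i)\<^sup>2 + (- (2 * t * (l i * Re (mat_trace (\<omega> i * W)))) + t\<^sup>2 * (Re (mat_trace (\<omega> i * W)))\<^sup>2))"
    proof (rule sum_mono)
      fix i assume i: "i \<in> I"
      have "mat_trace (\<omega> i * ?Y) = mat_trace (\<omega> i * X) + complex_of_real t * mat_trace (\<omega> i * W)"
      proof -
        have "\<omega> i * ?Y = \<omega> i * X + complex_of_real t \<cdot>\<^sub>m (\<omega> i * W)"
          using \<omega>[OF i] Xc W by (simp add: mult_add_distrib_mat[of _ n n _ n] mult_smult_distrib[of _ n n _ n])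
        then show ?thesis using \<omega>[OF i] Xc W by (simp add: trace_add[of _ n] trace_smult[of _ n])
      qed
      then have eq: "b i - Re (mat_trace (\<omega> i * ?Y))
          = (b i - Re (mat_trace (\<omega> i * X))) + (- t * Re (mat_trace (\<omega> i * W)))" by simp
      show "(max 0 (b i - Re (mat_trace (\<omega> i * ?Y))))\<^sup>2
          \<le> (l i)\<^sup>2 + (- (2 * t * (l i * Re (mat_trace (\<omega> i * W)))) + t\<^sup>2 * (Re (mat_trace (\<omega> i * W)))\<^sup>2)"
        unfolding eq by (rule order_trans[OF pos_part_square_le]) (simp add: l_def[symmetric] power_mult_distrib)
    qed
    also have "\<dots> = (\<Sum>i\<in>I. (l i)\<^sup>2) - 2 * t * (\<Sum>i\<in>I. l i * Re (mat_trace (\<omega> i * W)))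
        + t\<^sup>2 * (\<Sum>i\<in>I. (Re (mat_trace (\<omega> i * W)))\<^sup>2)"
      by (simp add: sum.distrib sum_negf sum_subtractf flip: sum_distrib_left)
    finally have "\<Phi> ?Y \<le> \<Phi> X + (2 * t * L W + t\<^sup>2 * q)"
      unfolding \<Phi>_def devY l_def[symmetric] L_def q_def by (simp add: algebra_simps)
    moreover have "\<Phi> X \<le> \<Phi> ?Y" by (rule min[OF feas[OF t]])
    ultimately show "0 \<le> 2 * t * L W + t\<^sup>2 * q" by simp
  qed
  have pos: "0 \<le> L W" if W: "psd n W" for W
    by (rule first_order) (use W psd_carrier[OF W] in \<open>auto intro!: psd_add[OF X] psd_smult\<close>)
  \<comment> \<open>Complementary slackness: X and -X are both feasible directions, because (1 - t)
    X stays positive for t \<le> 1.\<close>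
  have LX: "L X = 0"
  proof -
    let ?W = "complex_of_real (-1) \<cdot>\<^sub>m X"
    have "0 \<le> L ?W"
    proof (rule first_order)
      fix t :: real assume t: "0 < t" "t \<le> 1"
      have "X + complex_of_real t \<cdot>\<^sub>m ?W = complex_of_real (1 - t) \<cdot>\<^sub>m X"
        using Xc by (intro eq_matI) (auto simp: algebra_simps)
      then show "psd n (X + complex_of_real t \<cdot>\<^sub>m ?W)" using psd_smult[OF X, of "1 - t"] t by simp
    qed (use Xc in simp)
    moreover have "L ?W = - L X"
    proof -
      have "ptrace_B a d ?W = complex_of_real (-1) \<cdot>\<^sub>m ptrace_B a d X"
        by (rule eq_matI) (use Xc in \<open>auto simp: ptrace_B_def n_def mult_index_less sum_negf\<close>)
      then have "Re (mat_trace (Z * ptrace_B a d ?W)) = - Re (mat_trace (Z * ptrace_B a d X))"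
        using Zc by (simp add: mult_smult_distrib[of _ a a _ a] trace_smult[of _ a])
      moreover have "Re (mat_trace (\<omega> i * ?W)) = - Re (mat_trace (\<omega> i * X))" if "i \<in> I" for i
        using \<omega>[OF that] Xc by (simp add: mult_smult_distrib[of _ n n _ n] trace_smult[of _ n])
      ultimately show ?thesis by (simp add: L_def sum_negf)
    qed
    ultimately show ?thesis using pos[OF X] by simp
  qed
  define \<Omega> where "\<Omega> = mat_sum n I (\<lambda>i. complex_of_real (l i) \<cdot>\<^sub>m \<omega> i)"
  have \<Omega>c: "\<Omega> \<in> carrier_mat n n" by (simp add: \<Omega>_def)
  have kc: "kron_id a d Z \<in> carrier_mat n n" by (simp add: n_def)
  \<comment> \<open>By adjointness of \<open>kron_id\<close> and the partial trace,
    \<open>L W\<close> is the real part of the trace of \<open>W\<close> against this operator;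
    \<open>L\<close> being nonnegative on the cone means that the operator is positive.\<close>
  have "psd n (kron_id a d Z - \<Omega>)"
  proof -
    have "mat_adjoint (kron_id a d Z - \<Omega>) = mat_adjoint (kron_id a d Z) - mat_adjoint \<Omega>"
      using \<Omega>c kc by (intro eq_matI) auto
    moreover have "mat_adjoint \<Omega> = \<Omega>" unfolding \<Omega>_def
    proof (rule adjoint_mat_sum)
      fix i assume i: "i \<in> I"
      have "mat_adjoint (complex_of_real (l i) \<cdot>\<^sub>m \<omega> i) = complex_of_real (l i) \<cdot>\<^sub>m mat_adjoint (\<omega> i)"
        using \<omega>[OF i] by (intro eq_matI) auto
      then show "mat_adjoint (complex_of_real (l i) \<cdot>\<^sub>m \<omega> i) = complex_of_real (l i) \<cdot>\<^sub>m \<omega> i"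
        using \<omega>h[OF i] by simp
    qed (use \<omega> in simp)
    ultimately have "mat_adjoint (kron_id a d Z - \<Omega>) = kron_id a d Z - \<Omega>"
      using Zc Zh by (simp add: kron_id_adjoint)
    moreover have "0 \<le> Re (mat_trace ((kron_id a d Z - \<Omega>) * rank_one n v))" if v: "v \<in> carrier_vec n" for v
    proof -
      have "mat_trace (\<Omega> * rank_one n v) = (\<Sum>i\<in>I. complex_of_real (l i) * mat_trace (\<omega> i * rank_one n v))"
        unfolding \<Omega>_def using \<omega> by (simp add: trace_mat_sum_mult trace_smult_mult[of _ n])
      moreover have "mat_trace (kron_id a d Z * rank_one n v) = mat_trace (Z * ptrace_B a d (rank_one n v))"
        using Zc by (intro trace_kron_id_mult) (simp_all add: n_def)
      ultimately have "Re (mat_trace ((kron_id a d Z - \<Omega>) * rank_one n v)) = L (rank_one n v)"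
        using kc \<Omega>c by (simp add: trace_minus_mult[of _ n] L_def)
      then show ?thesis using pos[OF psd_rank_one[OF v]] by simp
    qed
    ultimately show ?thesis using kc \<Omega>c by (simp add: psd_iff_trace minus_carrier_mat)
  qed
  then have "(\<Sum>i\<in>I. l i * b i) \<le> Re (mat_trace (Z * \<sigma>))"
    unfolding \<Omega>_def by (intro dual[OF Zc Zh]) (auto simp: l_def)
  \<comment> \<open>Writing \<sigma> as the partial trace of \<open>X\<close> minus \<open>Z\<close>
    produces the trace of Z^2. With \<open>L X = 0\<close> the certificate inequality then bounds
    the sum of all squared residuals by 0.\<close>
  also have "\<dots> = Re (mat_trace (Z * ptrace_B a d X)) - Re (mat_trace (Z * Z))"
  proof -
    have "Z * Z = Z * ptrace_B a d X - Z * \<sigma>"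
      using Zc \<sigma>c by (subst (2) Z_def) (rule mult_minus_distrib_mat[of _ a a _ a], auto)
    then show ?thesis using Zc \<sigma>c by (simp add: trace_minus[of _ a])
  qed
  also have "Re (mat_trace (Z * ptrace_B a d X)) = (\<Sum>i\<in>I. l i * Re (mat_trace (\<omega> i * X)))"
    using LX by (simp add: L_def)
  finally have "(\<Sum>i\<in>I. l i * (b i - Re (mat_trace (\<omega> i * X)))) + Re (mat_trace (Z * Z)) \<le> 0"
    by (simp add: right_diff_distrib sum_subtractf)
  moreover have "l i * (b i - Re (mat_trace (\<omega> i * X))) = (l i)\<^sup>2" for i
    by (auto simp: l_def max_def power2_eq_square)
  moreover have "Re (mat_trace (Z * Z)) = (\<Sum>i<a. \<Sum>j<a. (cmod (Z $$ (i, j)))\<^sup>2)"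
    unfolding trace_mult_hermitian[OF Zc Zh Zc] cmod_power2 by (simp add: power2_eq_square)
  ultimately have sum0: "(\<Sum>i\<in>I. (l i)\<^sup>2) + (\<Sum>i<a. \<Sum>j<a. (cmod (Z $$ (i, j)))\<^sup>2) \<le> 0" by simp
  moreover have nn: "0 \<le> (\<Sum>i\<in>I. (l i)\<^sup>2)" "0 \<le> (\<Sum>i<a. \<Sum>j<a. (cmod (Z $$ (i, j)))\<^sup>2)"
    by (auto intro!: sum_nonneg)
  ultimately have z: "(\<Sum>i\<in>I. (l i)\<^sup>2) = 0" "(\<Sum>i<a. \<Sum>j<a. (cmod (Z $$ (i, j)))\<^sup>2) = 0" by linarith+
  have "b i \<le> Re (mat_trace (\<omega> i * X))" if "i \<in> I" for i
    using z(1) I that by (auto simp: sum_nonneg_eq_0_iff l_def max_def split: if_splits)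
  moreover have "ptrace_B a d X = \<sigma>"
  proof (rule eq_matI)
    fix i j assume "i < dim_row \<sigma>" "j < dim_col \<sigma>"
    then have ij: "i < a" "j < a" using \<sigma>c by auto
    have "(\<Sum>j<a. (cmod (Z $$ (i, j)))\<^sup>2) = 0"
      using z(2) ij by (subst (asm) sum_nonneg_eq_0_iff) (auto intro!: sum_nonneg)
    then have "Z $$ (i, j) = 0" using ij by (subst (asm) sum_nonneg_eq_0_iff) auto
    then show "ptrace_B a d X $$ (i, j) = \<sigma> $$ (i, j)" using Zi[OF ij] by simp
  qed (use \<sigma>c in \<open>auto simp: ptrace_B_def\<close>)
  ultimately show ?thesis using X unfolding n_def by blast
qed

section \<open>Extensions with small measured relative entropy\<close>

lemma trace_spectral_rank_one_col:
  assumes "unitary n U" "i < n"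
  shows "mat_trace (spectral n U d * rank_one n (col U i)) = d i"
  using conj_index_rank_one[of U n "spectral n U d" i] unitary_carrier[OF assms(1)] assms(2)
  unfolding unitary_conj_spectral[OF assms(1)] by (simp add: mat_diag_def)

lemma spectral_scale:
  assumes "U \<in> carrier_mat n n"
  shows "spectral n U (\<lambda>i. c * d i) = complex_of_real c \<cdot>\<^sub>m spectral n U d"
  by (rule eq_matI) (use assms in \<open>auto simp: spectral_index sum_distrib_left mult.assoc\<close>)

lemma trace_kron_id: "Y \<in> carrier_mat a a \<Longrightarrow> mat_trace (kron_id a b Y) = of_nat b * mat_trace Y"
  by (simp add: mat_trace_def sum_mult_index kron_id_index sum_distrib_left)

text \<open>The observable through which an extension enters its constraint: outcome
  \<open>x\<close> carries the value \<open>w x\<close>.\<close>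

definition weighted_povm :: "nat \<Rightarrow> nat \<Rightarrow> (nat \<Rightarrow> complex mat) \<Rightarrow> (nat \<Rightarrow> real) \<Rightarrow> complex mat" where
  "weighted_povm n k M w = mat_sum n {..<k} (\<lambda>x. complex_of_real (w x) \<cdot>\<^sub>m M x)"

lemma weighted_povm_carrier [simp]: "weighted_povm n k M w \<in> carrier_mat n n"
  by (simp add: weighted_povm_def)

lemma adjoint_weighted_povm:
  assumes "povm n k M" shows "mat_adjoint (weighted_povm n k M w) = weighted_povm n k M w"
  unfolding weighted_povm_def
proof (rule adjoint_mat_sum)
  fix x assume "x \<in> {..<k}"
  then have M: "psd n (M x)" using assms by (simp add: povm_def)
  then have "mat_adjoint (complex_of_real (w x) \<cdot>\<^sub>m M x) = complex_of_real (w x) \<cdot>\<^sub>m mat_adjoint (M x)"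
    using psd_carrier[OF M] by (intro eq_matI) auto
  then show "mat_adjoint (complex_of_real (w x) \<cdot>\<^sub>m M x) = complex_of_real (w x) \<cdot>\<^sub>m M x"
    using psd_adjoint[OF M] by simp
qed (use assms in \<open>auto simp: povm_def psd_carrier\<close>)

lemma trace_weighted_povm_mult:
  assumes "povm n k M" "X \<in> carrier_mat n n"
  shows "Re (mat_trace (weighted_povm n k M w * X)) = (\<Sum>x<k. w x * Re (mat_trace (M x * X)))"
proof -
  have "M x \<in> carrier_mat n n" if "x < k" for x
    using assms(1) that by (simp add: povm_def psd_carrier)
  then show ?thesis
    unfolding weighted_povm_def using assms(2)
    by (subst trace_mat_sum_mult) (auto simp: trace_smult_mult[of _ n])
qed

text \<open>
  Verifies the hypothesis on dual certificates of the duality above: after normalising \<open>\<Sum>l = 1\<close>, the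
  measurements are bounded by \<open>log Z\<close> on \<open>A\<close>, and \<open>c\<close> bounds the variational expression of \<open>Z\<close>.
\<close>

lemma dual_certificate_bound:
  fixes k :: "'i \<Rightarrow> nat" and a d :: nat
  defines "n \<equiv> a * d"
  assumes d: "0 < d" and I: "finite I" and \<rho>: "psd n \<rho>" and \<sigma>: "psd a \<sigma>"
    and M: "\<And>i. i \<in> I \<Longrightarrow> povm n (k i) (M i)" and w: "\<And>i x. i \<in> I \<Longrightarrow> x < k i \<Longrightarrow> 0 < w i x"
    and c: "\<And>E y. unitary a E \<Longrightarrow> (\<And>j. j < a \<Longrightarrow> 0 < y j) \<Longrightarrow>
      Re (mat_trace (spectral a E (\<lambda>j. ln (y j)) * ptrace_B a d \<rho>)) + 1 - Re (mat_trace (spectral a E y * \<sigma>)) \<le> c"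
    and Z: "Z \<in> carrier_mat a a" "mat_adjoint Z = Z" and l: "\<And>i. i \<in> I \<Longrightarrow> 0 \<le> l i"
    and dom: "psd n (kron_id a d Z - mat_sum n I (\<lambda>i. complex_of_real (l i) \<cdot>\<^sub>m weighted_povm n (k i) (M i) (w i)))"
  shows "(\<Sum>i\<in>I. l i * ((\<Sum>x<k i. Re (mat_trace (M i x * \<rho>)) * ln (w i x)) + 1 - c)) \<le> Re (mat_trace (Z * \<sigma>))"
proof -
  define \<Omega> where "\<Omega> = mat_sum n I (\<lambda>i. complex_of_real (l i) \<cdot>\<^sub>m weighted_povm n (k i) (M i) (w i))"
  have \<Omega>c: "\<Omega> \<in> carrier_mat n n" and kc [simp]: "kron_id a d Y \<in> carrier_mat n n" for Y
    by (simp_all add: \<Omega>_def n_def)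
  have Mp: "psd n (M i x)" if "i \<in> I" "x < k i" for i x using M[OF that(1)] that(2) by (simp add: povm_def)
  have tr\<Omega>: "Re (mat_trace (\<Omega> * X)) = (\<Sum>i\<in>I. l i * (\<Sum>x<k i. w i x * Re (mat_trace (M i x * X))))"
    if X: "X \<in> carrier_mat n n" for X
  proof -
    have "Re (mat_trace (\<Omega> * X)) = (\<Sum>i\<in>I. l i * Re (mat_trace (weighted_povm n (k i) (M i) (w i) * X)))"
      unfolding \<Omega>_def using X by (subst trace_mat_sum_mult) (auto simp: trace_smult_mult[of _ n])
    then show ?thesis using M X by (simp add: trace_weighted_povm_mult)
  qed
  \<comment> \<open>Testing the domination on \<open>P\<close> tensored with the identity isolates
    \<open>Z\<close>; the factor \<open>d\<close> is the trace of the identity on B.\<close>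
  have key: "Re (mat_trace (\<Omega> * kron_id a d P)) \<le> d * Re (mat_trace (Z * P))" if P: "psd a P" for P
  proof -
    note Pc = psd_carrier[OF P]
    have "0 \<le> Re (mat_trace ((kron_id a d Z - \<Omega>) * kron_id a d P))"
      using dom psd_kron_id[OF P, of d] unfolding \<Omega>_def n_def by (rule trace_psd_mult_nonneg)
    also have "\<dots> = Re (mat_trace (kron_id a d Z * kron_id a d P)) - Re (mat_trace (\<Omega> * kron_id a d P))"
      using \<Omega>c by (simp add: trace_minus_mult[of _ n])
    also have "mat_trace (kron_id a d Z * kron_id a d P) = of_nat d * mat_trace (Z * P)"
      using Z Pc by (simp add: kron_id_mult trace_kron_id)
    finally show ?thesis by simp
  qed
  have M0: "0 \<le> Re (mat_trace (M i x * kron_id a d P))" if "psd a P" "i \<in> I" "x < k i" for P i x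
    using Mp[OF that(2,3)] psd_kron_id[OF that(1), of d] unfolding n_def by (rule trace_psd_mult_nonneg)
  have wM0: "0 \<le> (\<Sum>x<k i. w i x * Re (mat_trace (M i x * kron_id a d P)))" if "psd a P" "i \<in> I" for P i
    using M0[OF that] w[OF that(2)] by (intro sum_nonneg mult_nonneg_nonneg) (auto simp: less_imp_le)
  define L where "L = (\<Sum>i\<in>I. l i)"
  show ?thesis
  proof (cases "L = 0")
    \<comment> \<open>With all multipliers 0 the claim reduces to nonnegativity of the trace of Z
      \<sigma>, which is \<open>key\<close> at \<sigma>.\<close>
    case True
    then have l0: "l i = 0" if "i \<in> I" for i
      using that I l by (simp add: L_def sum_nonneg_eq_0_iff)
    have "0 \<le> Re (mat_trace (\<Omega> * kron_id a d \<sigma>))" by (simp add: tr\<Omega> l0)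
    then have "0 \<le> d * Re (mat_trace (Z * \<sigma>))" using key[OF \<sigma>] by simp
    then show ?thesis using d by (simp add: l0 zero_le_mult_iff)
  next
    case False
    then have L: "0 < L" using l sum_nonneg[of I l] by (simp add: L_def less_le)
    from hermitian_spectral[OF Z] obtain E z where E: "unitary a E" and Zs: "Z = spectral a E z" by auto
    note Ec = unitary_carrier[OF E]
    define y where "y j = 1 / L * z j" for j
    have ys: "spectral a E y = complex_of_real (1 / L) \<cdot>\<^sub>m Z"
      unfolding y_def Zs spectral_scale[OF Ec] ..
    \<comment> \<open>\<open>ln (y j)\<close> calls for strict positivity. An eigenvalue at most 0
      would make all elements of a POVM with \<open>l i \<noteq> 0\<close> have trace 0 against the
      eigenprojection tensored with the identity, whereas these traces add up to
      \<open>d\<close>.\<close>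
    have y: "0 < y j" if j: "j < a" for j
    proof (rule ccontr)
      define P where "P = rank_one a (col E j)"
      have "col E j \<in> carrier_vec a" using Ec j by (intro carrier_vecI) simp
      then have P: "psd a P" unfolding P_def by (rule psd_rank_one)
      assume neg: "\<not> 0 < y j"
      have "z j \<le> 0"
      proof (rule ccontr)
        assume "\<not> z j \<le> 0"
        with L have "0 < 1 / L * z j" by (intro mult_pos_pos) simp_all
        with neg show False unfolding y_def by blast
      qed
      then have "d * Re (mat_trace (Z * P)) \<le> 0"
        unfolding P_def Zs trace_spectral_rank_one_col[OF E j] by (simp add: mult_nonneg_nonpos)
      then have le: "(\<Sum>i\<in>I. l i * (\<Sum>x<k i. w i x * Re (mat_trace (M i x * kron_id a d P)))) \<le> 0"
        using key[OF P] by (simp add: tr\<Omega>)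
      have nn: "0 \<le> l i * (\<Sum>x<k i. w i x * Re (mat_trace (M i x * kron_id a d P)))" if "i \<in> I" for i
        using l[OF that] wM0[OF P that] by simp
      have "\<exists>i\<in>I. l i \<noteq> 0" using False unfolding L_def by (metis sum.neutral)
      then obtain i where i: "i \<in> I" "l i \<noteq> 0" by blast
      have "(\<Sum>i\<in>I. l i * (\<Sum>x<k i. w i x * Re (mat_trace (M i x * kron_id a d P)))) = 0"
        using order_antisym[OF le sum_nonneg[OF nn]] by simp
      then have "(\<Sum>x<k i. w i x * Re (mat_trace (M i x * kron_id a d P))) = 0"
        using i nn I by (auto simp: sum_nonneg_eq_0_iff)
      moreover have "0 \<le> w i x * Re (mat_trace (M i x * kron_id a d P))" if "x < k i" for x
        using M0[OF P i(1) that] w[OF i(1) that] by simp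
      ultimately have "\<forall>x<k i. w i x * Re (mat_trace (M i x * kron_id a d P)) = 0"
        by (subst (asm) sum_nonneg_eq_0_iff) auto
      then have "\<forall>x<k i. Re (mat_trace (M i x * kron_id a d P)) = 0"
        using w[OF i(1)] by fastforce
      then have "Re (mat_trace (kron_id a d P)) = 0"
        using arg_cong[OF povm_sum_trace[OF M[OF i(1)], of "kron_id a d P"], of Re] by simp
      moreover have "mat_trace P = 1"
        using trace_spectral_rank_one_col[OF E j, of "\<lambda>_. 1"] unfolding spectral_one[OF E] P_def
        by (simp add: left_mult_one_mat[of _ a a])
      ultimately show False using d trace_kron_id[of P a d] psd_carrier[OF P] by simp
    qed
    define u where "u i = l i / L" for i
    \<comment> \<open>Drawing the i-th POVM with probability \<open>u i\<close> merges all of them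
      into one POVM on the disjoint union of the outcome sets, to which the single-measurement bound
      applies.\<close>
    define J where "J = Sigma I (\<lambda>i. {..<k i})"
    define N where "N = (\<lambda>(i, x). complex_of_real (u i) \<cdot>\<^sub>m M i x)"
    define v where "v = (\<lambda>(i, x). w i x)"
    have Np: "psd n (N j)" if j: "j \<in> J" for j
    proof -
      from j obtain i x where ix: "j = (i, x)" "i \<in> I" "x < k i" by (auto simp: J_def)
      have "0 \<le> u i" using l[OF ix(2)] L by (simp add: u_def)
      with Mp[OF ix(2,3)] have "psd n (complex_of_real (u i) \<cdot>\<^sub>m M i x)" by (rule psd_smult)
      then show ?thesis by (simp add: N_def ix)
    qed
    have Mc: "M i x \<in> carrier_mat n n" if "i \<in> I" "x < k i" for i x using Mp[OF that] by (rule psd_carrier)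
    note Md [simp] = carrier_matD[OF Mc]
    have entry: "mat_sum n J (\<lambda>j. complex_of_real (f j) \<cdot>\<^sub>m N j) $$ (r, s)
        = (\<Sum>i\<in>I. complex_of_real (u i) * (\<Sum>x<k i. complex_of_real (f (i, x)) * M i x $$ (r, s)))"
      if rs: "r < n" "s < n" for f r s
    proof -
      have "mat_sum n J (\<lambda>j. complex_of_real (f j) \<cdot>\<^sub>m N j) $$ (r, s)
          = (\<Sum>(i, x)\<in>J. complex_of_real (u i) * (complex_of_real (f (i, x)) * M i x $$ (r, s)))"
        using rs Mc by (auto simp: mat_sum_def N_def J_def intro!: sum.cong)
      also have "\<dots> = (\<Sum>i\<in>I. complex_of_real (u i) * (\<Sum>x<k i. complex_of_real (f (i, x)) * M i x $$ (r, s)))"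
        unfolding J_def using I by (simp add: sum.Sigma[symmetric] sum_distrib_left)
      finally show ?thesis .
    qed
    have one: "mat_sum n J N = 1\<^sub>m n"
    proof (rule eq_matI)
      fix r s assume "r < dim_row (1\<^sub>m n :: complex mat)" "s < dim_col (1\<^sub>m n :: complex mat)"
      then have rs: "r < n" "s < n" by auto
      have "(\<Sum>x<k i. M i x $$ (r, s)) = 1\<^sub>m n $$ (r, s)" if "i \<in> I" for i
      proof -
        have "mat n n (\<lambda>ij. \<Sum>x<k i. M i x $$ ij) $$ (r, s) = 1\<^sub>m n $$ (r, s)"
          using M[OF that] unfolding povm_def by simp
        then show ?thesis using rs by simp
      qed
      moreover have "mat_sum n J N $$ (r, s) = mat_sum n J (\<lambda>j. complex_of_real 1 \<cdot>\<^sub>m N j) $$ (r, s)"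
        using rs Mc by (auto simp: mat_sum_def N_def J_def intro!: sum.cong)
      ultimately have "mat_sum n J N $$ (r, s) = (\<Sum>i\<in>I. complex_of_real (u i) * 1\<^sub>m n $$ (r, s))"
        using rs unfolding entry[OF rs] by simp
      also have "\<dots> = complex_of_real (\<Sum>i\<in>I. u i) * 1\<^sub>m n $$ (r, s)"
        by (simp only: sum_distrib_right of_real_sum)
      also have "(\<Sum>i\<in>I. u i) = 1"
        using L by (simp add: u_def L_def sum_divide_distrib[symmetric])
      finally show "mat_sum n J N $$ (r, s) = 1\<^sub>m n $$ (r, s)" by simp
    qed (auto simp: mat_sum_def)
    have "kron_id a d (spectral a E y) - mat_sum n J (\<lambda>j. complex_of_real (v j) \<cdot>\<^sub>m N j)
        = complex_of_real (1 / L) \<cdot>\<^sub>m (kron_id a d Z - \<Omega>)"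
    proof (rule eq_matI)
      fix r s assume "r < dim_row (complex_of_real (1 / L) \<cdot>\<^sub>m (kron_id a d Z - \<Omega>))"
        "s < dim_col (complex_of_real (1 / L) \<cdot>\<^sub>m (kron_id a d Z - \<Omega>))"
      then have rs: "r < n" "s < n" using \<Omega>c by auto
      then have "0 < d" by (auto simp: n_def intro: gr0I)
      have "r div d < a" "s div d < a" using rs by (auto simp: n_def less_mult_imp_div_less)
      then have "kron_id a d (spectral a E y) $$ (r, s) = complex_of_real (1 / L) * kron_id a d Z $$ (r, s)"
        unfolding ys using rs Z by (simp add: kron_id_def n_def)
      moreover have "\<Omega> $$ (r, s) = (\<Sum>i\<in>I. complex_of_real (l i) * (\<Sum>x<k i. complex_of_real (w i x) * M i x $$ (r, s)))"
        using rs Mc by (auto simp: \<Omega>_def mat_sum_def weighted_povm_def intro!: sum.cong)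
      moreover have "mat_sum n J (\<lambda>j. complex_of_real (v j) \<cdot>\<^sub>m N j) $$ (r, s)
          = complex_of_real (1 / L) * (\<Sum>i\<in>I. complex_of_real (l i) * (\<Sum>x<k i. complex_of_real (w i x) * M i x $$ (r, s)))"
        unfolding entry[OF rs] v_def sum_distrib_left[of _ _ I] by (simp add: u_def)
      ultimately show "(kron_id a d (spectral a E y) - mat_sum n J (\<lambda>j. complex_of_real (v j) \<cdot>\<^sub>m N j)) $$ (r, s)
          = (complex_of_real (1 / L) \<cdot>\<^sub>m (kron_id a d Z - \<Omega>)) $$ (r, s)"
        using rs \<Omega>c by (simp add: carrier_matD[OF kc] carrier_matD[OF mat_sum_carrier] right_diff_distrib)
    qed (use \<Omega>c in \<open>auto simp: mat_sum_def n_def\<close>)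
    moreover have "psd n (complex_of_real (1 / L) \<cdot>\<^sub>m (kron_id a d Z - \<Omega>))"
      using dom L unfolding \<Omega>_def by (intro psd_smult) auto
    ultimately have dom': "psd n (kron_id a d (spectral a E y) - mat_sum n J (\<lambda>j. complex_of_real (v j) \<cdot>\<^sub>m N j))"
      by simp
    have "(\<Sum>j\<in>J. Re (mat_trace (N j * \<rho>)) * ln (v j)) \<le> Re (mat_trace (spectral a E (\<lambda>j. ln (y j)) * ptrace_B a d \<rho>))"
      by (rule sum_log_measurement_le[of J a d N v \<rho> E y])
        (use Np I w one \<rho> E y dom' in \<open>auto simp: n_def J_def v_def\<close>)
    also have "\<dots> \<le> c - 1 + Re (mat_trace (Z * \<sigma>)) / L"
      using c[of E y, OF E y] Z psd_carrier[OF \<sigma>] unfolding ys by (simp add: trace_smult_mult[of _ a])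
    finally have le: "(\<Sum>j\<in>J. Re (mat_trace (N j * \<rho>)) * ln (v j)) \<le> c - 1 + Re (mat_trace (Z * \<sigma>)) / L" .
    have "(\<Sum>j\<in>J. Re (mat_trace (N j * \<rho>)) * ln (v j))
        = (\<Sum>(i, x)\<in>J. u i * (Re (mat_trace (M i x * \<rho>)) * ln (w i x)))"
      using Mc psd_carrier[OF \<rho>] by (intro sum.cong) (auto simp: J_def N_def v_def trace_smult_mult[of _ n])
    also have "\<dots> = (\<Sum>i\<in>I. u i * (\<Sum>x<k i. Re (mat_trace (M i x * \<rho>)) * ln (w i x)))"
      unfolding J_def using I by (simp add: sum.Sigma[symmetric] sum_distrib_left)
    also have "\<dots> = (\<Sum>i\<in>I. l i * (\<Sum>x<k i. Re (mat_trace (M i x * \<rho>)) * ln (w i x))) / L"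
      by (simp add: u_def sum_divide_distrib)
    finally have "(\<Sum>i\<in>I. l i * (\<Sum>x<k i. Re (mat_trace (M i x * \<rho>)) * ln (w i x))) \<le> L * (c - 1) + Re (mat_trace (Z * \<sigma>))"
      using le L by (simp add: field_simps)
    moreover have "(\<Sum>i\<in>I. l i * ((\<Sum>x<k i. Re (mat_trace (M i x * \<rho>)) * ln (w i x)) + 1 - c))
        = (\<Sum>i\<in>I. l i * (\<Sum>x<k i. Re (mat_trace (M i x * \<rho>)) * ln (w i x))) + L * (1 - c)"
      unfolding L_def sum_distrib_right sum.distrib[symmetric]
      by (intro sum.cong refl) (simp add: right_diff_distrib distrib_left)
    ultimately show ?thesis by (simp add: right_diff_distrib)
  qed
qed

lemma exists_extension_measured_le:
  assumes \<rho>: "\<rho> \<in> density_mats (a * d)" and \<sigma>: "\<sigma> \<in> density_mats a"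
    and c: "\<And>E y. unitary a E \<Longrightarrow> (\<And>j. j < a \<Longrightarrow> 0 < y j) \<Longrightarrow>
      Re (mat_trace (spectral a E (\<lambda>j. ln (y j)) * ptrace_B a d \<rho>)) + 1 - Re (mat_trace (spectral a E y * \<sigma>)) \<le> c"
  shows "\<exists>\<tau>\<in>extensions a d \<sigma>. measured_rel_entropy \<rho> \<tau> \<le> ereal c"
proof -
  define n where "n = a * d"
  have \<rho>p: "psd n \<rho>" and \<rho>1: "mat_trace \<rho> = 1" and \<sigma>p: "psd a \<sigma>" and \<sigma>1: "mat_trace \<sigma> = 1"
    using \<rho> \<sigma> by (auto simp: density_mats_def n_def)
  have d: "0 < d" using \<rho>1 psd_carrier[OF \<rho>p] by (intro gr0I) (simp add: mat_trace_def n_def)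
  define T where "T = {(k, M, w :: nat \<Rightarrow> real). povm n k M \<and> (\<forall>x<k. 0 < w x)}"
  define \<beta> where "\<beta> = (\<lambda>(k :: nat, M, w). (\<Sum>x<k. Re (mat_trace (M x * \<rho>)) * ln (w x)) + 1 - c)"
  define \<omega> where "\<omega> = (\<lambda>(k :: nat, M, w). weighted_povm n k M w)"
  \<comment> \<open>Trace at most 1 suffices here: the marginal condition in \<open>S\<close>
    already fixes the trace.\<close>
  define K where "K = {X :: nat \<times> nat \<Rightarrow> complex. (\<forall>ij. ij \<notin> {..<n} \<times> {..<n} \<longrightarrow> X ij = 0) \<and>
     psd n (mat n n X) \<and> Re (mat_trace (mat n n X)) \<le> 1}"
  define S where "S = (\<Inter>i\<in>{..<a}. \<Inter>j\<in>{..<a}. {X. ptrace_B a d (mat n n X) $$ (i, j) = \<sigma> $$ (i, j)})"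
  define C where "C = (\<lambda>t :: nat \<times> (nat \<Rightarrow> complex mat) \<times> (nat \<Rightarrow> real). {X. \<beta> t \<le> Re (mat_trace (\<omega> t * mat n n X))})"
  have \<omega>c: "\<omega> t \<in> carrier_mat n n" for t by (simp add: \<omega>_def case_prod_unfold)
  have S_iff: "X \<in> S \<longleftrightarrow> ptrace_B a d (mat n n X) = \<sigma>" for X
  proof
    assume X: "X \<in> S"
    show "ptrace_B a d (mat n n X) = \<sigma>"
      by (rule eq_matI) (use X psd_carrier[OF \<sigma>p] in \<open>auto simp: S_def ptrace_B_def\<close>)
  qed (auto simp: S_def)
  have "compact (K \<inter> S)"
  proof (rule compact_Int_closed)
    show "compact K" unfolding K_def by (rule compact_psd_trace_le)
    show "closed S" unfolding S_def n_def
      by (intro closed_INT ballI closed_Collect_eq ptrace_mat_continuous continuous_on_const) auto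
  qed
  moreover have "closed (C t)" for t
    unfolding C_def by (intro closed_Collect_le continuous_on_const continuous_on_Re trace_mult_mat_continuous \<omega>c)
  moreover have "(K \<inter> S) \<inter> (\<Inter>t\<in>F. C t) \<noteq> {}" if F: "finite F" "F \<subseteq> T" for F
  proof -
    have M: "povm (a * d) (fst t) (fst (snd t))" if "t \<in> F" for t
      using that F(2) by (auto simp: T_def n_def)
    have "\<exists>X. psd (a * d) X \<and> ptrace_B a d X = \<sigma> \<and> (\<forall>t\<in>F. \<beta> t \<le> Re (mat_trace (\<omega> t * X)))"
    proof (rule exists_extension_finite[OF \<sigma>p F(1)])
      fix Z and l :: "_ \<Rightarrow> real"
      assume Z: "Z \<in> carrier_mat a a" "mat_adjoint Z = Z" and l: "\<And>t. t \<in> F \<Longrightarrow> 0 \<le> l t"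
        and dom: "psd (a * d) (kron_id a d Z - mat_sum (a * d) F (\<lambda>t. complex_of_real (l t) \<cdot>\<^sub>m \<omega> t))"
      have w: "0 < snd (snd t) x" if "t \<in> F" "x < fst t" for t x
        using that F(2) by (auto simp: T_def)
      have dom': "psd (a * d) (kron_id a d Z - mat_sum (a * d) F (\<lambda>t. complex_of_real (l t) \<cdot>\<^sub>m
          weighted_povm (a * d) (fst t) (fst (snd t)) (snd (snd t))))"
        using dom by (simp add: \<omega>_def case_prod_unfold n_def)
      have "(\<Sum>t\<in>F. l t * ((\<Sum>x<fst t. Re (mat_trace (fst (snd t) x * \<rho>)) * ln (snd (snd t) x)) + 1 - c))
          \<le> Re (mat_trace (Z * \<sigma>))"
        by (rule dual_certificate_bound[where a = a and d = d and k = fst and M = "\<lambda>t. fst (snd t)"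
              and w = "\<lambda>t. snd (snd t)"])
          (fact d F(1) \<rho>p[unfolded n_def] \<sigma>p Z dom' | rule M w l c; blast)+
      then show "(\<Sum>t\<in>F. l t * \<beta> t) \<le> Re (mat_trace (Z * \<sigma>))"
        by (simp add: \<beta>_def case_prod_unfold)
    qed (use \<omega>c M in \<open>auto simp: \<omega>_def n_def case_prod_unfold adjoint_weighted_povm\<close>)
    then obtain X where X: "psd n X" "ptrace_B a d X = \<sigma>" "\<And>t. t \<in> F \<Longrightarrow> \<beta> t \<le> Re (mat_trace (\<omega> t * X))"
      by (auto simp: n_def)
    note Xc = psd_carrier[OF X(1)]
    have "mat_trace X = 1" using trace_ptrace[of X a d] Xc X(2) \<sigma>1 by (simp add: n_def)
    then have "entries n X \<in> (K \<inter> S) \<inter> (\<Inter>t\<in>F. C t)"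
      using X Xc by (auto simp: K_def S_iff C_def entries_outside)
    then show ?thesis by blast
  qed
  \<comment> \<open>Here the quantifiers are exchanged: from one extension for each finite family to
    a single extension for all POVMs and weights.\<close>
  ultimately have "(K \<inter> S) \<inter> (\<Inter>t\<in>T. C t) \<noteq> {}"
    by (rule compact_imp_fip_image)
  then obtain x where x: "x \<in> K" "x \<in> S" "\<And>t. t \<in> T \<Longrightarrow> x \<in> C t" by blast
  define \<tau> where "\<tau> = mat n n x"
  have \<tau>: "psd n \<tau>" "ptrace_B a d \<tau> = \<sigma>" using x by (auto simp: K_def S_iff \<tau>_def)
  note \<tau>c = psd_carrier[OF \<tau>(1)]
  have "\<tau> \<in> extensions a d \<sigma>"
    using \<tau> trace_ptrace[of \<tau> a d] \<tau>c \<sigma>1 by (simp add: extensions_def density_mats_def n_def)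
  moreover have "measured_rel_entropy \<rho> \<tau> \<le> ereal c"
  proof (rule measured_rel_entropy_leI[OF \<rho>[folded n_def] \<tau>(1)])
    fix k M and w :: "nat \<Rightarrow> real"
    assume M: "povm n k M" and w: "\<And>x. x < k \<Longrightarrow> 0 < w x"
    have "\<beta> (k, M, w) \<le> Re (mat_trace (\<omega> (k, M, w) * \<tau>))"
      using x(3)[of "(k, M, w)"] M w by (auto simp: T_def C_def \<tau>_def)
    then show "(\<Sum>x<k. Re (mat_trace (M x * \<rho>)) * ln (w x)) + 1 - (\<Sum>x<k. Re (mat_trace (M x * \<tau>)) * w x) \<le> c"
      using trace_weighted_povm_mult[OF M \<tau>c, of w] by (simp add: \<beta>_def \<omega>_def mult.commute)
  qed
  ultimately show ?thesis by blast
qed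

theorem theorem4p2:
  fixes dA dB :: nat and \<rho> \<sigma> :: "complex mat"
  assumes "\<rho> \<in> density_mats (dA * dB)"
    and "\<sigma> \<in> density_mats dA"
  shows "measured_rel_entropy (ptrace_B dA dB \<rho>) \<sigma>
           \<le> measured_rel_entropy_set \<rho> (extensions dA dB \<sigma>)
       \<and> measured_rel_entropy_set \<rho> (extensions dA dB \<sigma>)
           \<le> rel_entropy (ptrace_B dA dB \<rho>) \<sigma>"
proof
  show "measured_rel_entropy (ptrace_B dA dB \<rho>) \<sigma> \<le> measured_rel_entropy_set \<rho> (extensions dA dB \<sigma>)"
    unfolding measured_rel_entropy_set_def
  proof (rule INF_greatest)
    fix \<tau> assume "\<tau> \<in> extensions dA dB \<sigma>"
    then have "psd (dA * dB) \<tau>" "ptrace_B dA dB \<tau> = \<sigma>" by (auto simp: extensions_def density_mats_def)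
    then show "measured_rel_entropy (ptrace_B dA dB \<rho>) \<sigma> \<le> measured_rel_entropy \<rho> \<tau>"
      using measured_rel_entropy_ptrace_le[of dA dB \<rho> \<tau>] assms(1) by (simp add: density_mats_def)
  qed
next
  let ?\<rho>A = "ptrace_B dA dB \<rho>"
  show "measured_rel_entropy_set \<rho> (extensions dA dB \<sigma>) \<le> rel_entropy ?\<rho>A \<sigma>"
  proof (cases "supp ?\<rho>A \<subseteq> supp \<sigma>")
    case False
    then show ?thesis by (simp add: rel_entropy_def)
  next
    case True
    have \<rho>: "psd (dA * dB) \<rho>" "mat_trace \<rho> = 1" and \<sigma>: "psd dA \<sigma>"
      using assms by (auto simp: density_mats_def)
    obtain U p where U: "unitary dA U" and \<rho>U: "?\<rho>A = spectral dA U p" and p: "\<And>i. i < dA \<Longrightarrow> 0 \<le> p i"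
      using psd_spectralE[OF psd_ptrace[OF \<rho>(1)]] by metis
    obtain V q where V: "unitary dA V" and \<sigma>V: "\<sigma> = spectral dA V q" and q: "\<And>i. i < dA \<Longrightarrow> 0 \<le> q i"
      using psd_spectralE[OF \<sigma>] by metis
    have tr: "mat_trace (spectral dA U p) = 1"
      using trace_ptrace[OF psd_carrier[OF \<rho>(1)]] \<rho>(2) \<rho>U by simp
    define c where "c = Re (mat_trace (?\<rho>A * (mat_log ?\<rho>A - mat_log \<sigma>)))"
    \<comment> \<open>The support inclusion enters through the orthogonality of eigenvectors; with
      it the finite value \<open>c\<close> bounds the variational expression of every positive test
      operator on A.\<close>
    have "\<exists>\<tau>\<in>extensions dA dB \<sigma>. measured_rel_entropy \<rho> \<tau> \<le> ereal c"
    proof (rule exists_extension_measured_le[OF assms])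
      fix E and y :: "nat \<Rightarrow> real" assume "unitary dA E" "\<And>j. j < dA \<Longrightarrow> 0 < y j"
      then show "Re (mat_trace (spectral dA E (\<lambda>j. ln (y j)) * ?\<rho>A)) + 1 - Re (mat_trace (spectral dA E y * \<sigma>)) \<le> c"
        unfolding c_def \<rho>U \<sigma>V
        by (intro log_variational_le_relative_entropy[OF U V] p q tr
            supp_spectral_subset_orthogonal[OF U V True[unfolded \<rho>U \<sigma>V]])
    qed
    then have "measured_rel_entropy_set \<rho> (extensions dA dB \<sigma>) \<le> ereal c"
      unfolding measured_rel_entropy_set_def by (blast intro: INF_lower2)
    then show ?thesis using True by (simp add: rel_entropy_def c_def)
  qed
qed

end
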